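(* Let $\mathbb{T}$ be a semi-abelian theory with constant $e$ and let $A$ be a topological $\mathbb{T}$-algebra. Let $A'$ be a sub $\mathbb{T}$-algebra of $A$ and let $B$ be the fundamental group $\pi_1(A',e)$, regarded as a subgroup of $\pi_1(A,e)$ (that is, the image of $\pi_1(A',e)$ under the homomorphism induced by the inclusion). Then $\widetilde{A}_B$, with the operations $\tau(\langle\beta_1\rangle_B,\dots,\langle\beta_n\rangle_B)=\langle\tau(\beta_1,\dots,\beta_n)\rangle_B$, is a topological $\mathbb{T}$-algebra such that the map $p\colon(\widetilde{A}_B,\tilde e)\to(A,e)$ is a continuous $\mathbb{T}$-homomorphism.
   Context: An algebraic theory (in the sense of Lawvere) $\mathbb{T}$ is a category with objects $T^0,T,T^2,T^3,\dots$, where $T^n$ is the $n$-fold product of a distinguished object $T$ with itself, with chosen projections. Morphisms $T^n\to T$ are called $n$-ary operations; $0$-ary operations are called constants. A $\mathbb{T}$-algebra is a product-preserving functor $\mathbb{T}\to\mathsf{Set}$; equivalently, a set $A$ with a map $\tau=\tau_A\colon A^n\to A$ for each $n$-ary operation $\tau$, compatible with composition and projections in $\mathbb{T}$. A $\mathbb{T}$-homomorphism is a map commuting with all operations. A sub $\mathbb{T}$-algebra is a subset closed under all operations (with the subspace topology in the topological case). The category of $\mathbb{T}$-algebras is $\mathsf{Set}^{\mathbb{T}}$. The theory $\mathbb{T}$ is called semi-abelian if $\mathsf{Set}^{\mathbb{T}}$ is a semi-abelian category (Barr-exact, protomodular, with finite coproducts and a zero object); equivalently (Bourn--Janelidze),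 $\mathbb{T}$ has a unique constant $e$ and, for some natural number $n$, has binary operations $\alpha_1,\dots,\alpha_n$ with $\alpha_i(X,X)=e$ and an $(n+1)$-ary operation $\theta$ with $\theta(\alpha_1(X,Y),\dots,\alpha_n(X,Y),Y)=X$. The element of a $\mathbb{T}$-algebra given by the constant is also denoted $e$. A topological $\mathbb{T}$-algebra is a topological space $A$ with a $\mathbb{T}$-algebra structure such that every operation $\tau_A\colon A^n\to A$ is continuous. For paths $\beta_1,\dots,\beta_n$ in $A$ starting at $e$, $\tau(\beta_1,\dots,\beta_n)$ denotes the path $t\mapsto\tau(\beta_1(t),\dots,\beta_n(t))$, which again starts at $e$. Construction of $\widetilde{X}_G$: let $X$ be a topological space, $x_0\in X$ and $G$ a subgroup of $\pi_1(X,x_0)$. On the set of paths in $X$ starting at $x_0$ define $\beta\simeq\gamma$ iff $\beta(1)=\gamma(1)$ and $[\beta\circ\gamma^{-1}]\in G$, where $\circ$ is concatenation (first $\beta$, then the reverse of $\gamma$). Let $\langle\beta\rangle_G$ be the class of $\beta$, $\widetilde{X}_G$ the set of classes, $\tilde x_0$ the class of the constant path at $x_0$, and $p\colon\widetilde{X}_G\to X$, $p(\langle\beta\rangle_G)=\beta(1)$. The topology on $\widetilde{X}_G$ has as basis the sets $(\langle\beta\rangle_G,U)=\{\langle\beta\circ\lambda\rangle_G : \lambda \text{ a path in } U \text{ with } \lambda(0)=\beta(1)\}$, for $U$ an open neighbourhood of $\beta(1)$. Here this is applied with $X=A$, $x_0=e$, $G=B$, and $\tilde e=\tilde x_0$.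 *)

theory Defs
  imports "HOL-Analysis.Analysis" "HOL-Algebra.Group"
begin

section \<open>Categories\<close>

record ('o, 'm) cat =
  Obj :: "'o set"
  Arr :: "'m set"
  Dom :: "'m \<Rightarrow> 'o"
  Cod :: "'m \<Rightarrow> 'o"
  Ident :: "'o \<Rightarrow> 'm"
  Comp :: "'m \<Rightarrow> 'm \<Rightarrow> 'm"  (* Comp C g f is "g after f" *)

definition homset :: "('o, 'm, 'z) cat_scheme \<Rightarrow> 'o \<Rightarrow> 'o \<Rightarrow> 'm set" where
  "homset C a b = {f \<in> Arr C. Dom C f = a \<and> Cod C f = b}"

definition category :: "('o, 'm, 'z) cat_scheme \<Rightarrow> bool" where
  "category C \<longleftrightarrow>
     (\<forall>f\<in>Arr C. Dom C f \<in> Obj C \<and> Cod C f \<in> Obj C) \<and>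
     (\<forall>a\<in>Obj C. Ident C a \<in> homset C a a) \<and>
     (\<forall>f\<in>Arr C. \<forall>g\<in>Arr C. Cod C f = Dom C g \<longrightarrow> Comp C g f \<in> homset C (Dom C f) (Cod C g)) \<and>
     (\<forall>f\<in>Arr C. Comp C f (Ident C (Dom C f)) = f \<and> Comp C (Ident C (Cod C f)) f = f) \<and>
     (\<forall>f\<in>Arr C. \<forall>g\<in>Arr C. \<forall>h\<in>Arr C. Cod C f = Dom C g \<and> Cod C g = Dom C h \<longrightarrow>
        Comp C h (Comp C g f) = Comp C (Comp C h g) f)"

definition is_iso :: "('o, 'm, 'z) cat_scheme \<Rightarrow> 'm \<Rightarrow> bool" where
  "is_iso C f \<longleftrightarrow> f \<in> Arr C \<and>
     (\<exists>g\<in>homset C (Cod C f) (Dom C f).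
        Comp C g f = Ident C (Dom C f) \<and> Comp C f g = Ident C (Cod C f))"

definition is_terminal :: "('o, 'm, 'z) cat_scheme \<Rightarrow> 'o \<Rightarrow> bool" where
  "is_terminal C t \<longleftrightarrow> t \<in> Obj C \<and> (\<forall>a\<in>Obj C. \<exists>!f. f \<in> homset C a t)"

definition is_initial :: "('o, 'm, 'z) cat_scheme \<Rightarrow> 'o \<Rightarrow> bool" where
  "is_initial C t \<longleftrightarrow> t \<in> Obj C \<and> (\<forall>a\<in>Obj C. \<exists>!f. f \<in> homset C t a)"

definition has_zero_object :: "('o, 'm, 'z) cat_scheme \<Rightarrow> bool" where
  "has_zero_object C \<longleftrightarrow> (\<exists>z. is_initial C z \<and> is_terminal C z)"

definition is_product ::
  "('o, 'm, 'z) cat_scheme \<Rightarrow> 'i set \<Rightarrow> ('i \<Rightarrow> 'o) \<Rightarrow> 'o \<Rightarrow> ('i \<Rightarrow> 'm) \<Rightarrow> bool" where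
  "is_product C I a p \<pi> \<longleftrightarrow> p \<in> Obj C \<and> (\<forall>i\<in>I. \<pi> i \<in> homset C p (a i)) \<and>
     (\<forall>x\<in>Obj C. \<forall>f. (\<forall>i\<in>I. f i \<in> homset C x (a i)) \<longrightarrow>
        (\<exists>!u. u \<in> homset C x p \<and> (\<forall>i\<in>I. Comp C (\<pi> i) u = f i)))"

definition is_coproduct ::
  "('o, 'm, 'z) cat_scheme \<Rightarrow> 'i set \<Rightarrow> ('i \<Rightarrow> 'o) \<Rightarrow> 'o \<Rightarrow> ('i \<Rightarrow> 'm) \<Rightarrow> bool" where
  "is_coproduct C I a q \<kappa> \<longleftrightarrow> q \<in> Obj C \<and> (\<forall>i\<in>I. \<kappa> i \<in> homset C (a i) q) \<and>
     (\<forall>x\<in>Obj C. \<forall>f. (\<forall>i\<in>I. f i \<in> homset C (a i) x) \<longrightarrow>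
        (\<exists>!u. u \<in> homset C q x \<and> (\<forall>i\<in>I. Comp C u (\<kappa> i) = f i)))"

definition has_finite_coproducts :: "('o, 'm, 'z) cat_scheme \<Rightarrow> bool" where
  "has_finite_coproducts C \<longleftrightarrow>
     (\<forall>(n::nat) a. (\<forall>i<n. a i \<in> Obj C) \<longrightarrow> (\<exists>q \<kappa>. is_coproduct C {..<n} a q \<kappa>))"

text \<open>\<open>p\<close> and \<open>q\<close> are the projections of a pullback of \<open>f\<close> and \<open>g\<close>, so that \<open>f p = g q\<close>.\<close>

definition is_pullback :: "('o, 'm, 'z) cat_scheme \<Rightarrow> 'm \<Rightarrow> 'm \<Rightarrow> 'm \<Rightarrow> 'm \<Rightarrow> bool" where
  "is_pullback C f g p q \<longleftrightarrow>
     f \<in> Arr C \<and> g \<in> Arr C \<and> Cod C f = Cod C g \<and>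
     p \<in> Arr C \<and> q \<in> Arr C \<and> Dom C p = Dom C q \<and> Cod C p = Dom C f \<and> Cod C q = Dom C g \<and>
     Comp C f p = Comp C g q \<and>
     (\<forall>x\<in>Obj C. \<forall>u\<in>homset C x (Dom C f). \<forall>v\<in>homset C x (Dom C g).
        Comp C f u = Comp C g v \<longrightarrow>
        (\<exists>!w. w \<in> homset C x (Dom C p) \<and> Comp C p w = u \<and> Comp C q w = v))"

definition has_pullbacks :: "('o, 'm, 'z) cat_scheme \<Rightarrow> bool" where
  "has_pullbacks C \<longleftrightarrow>
     (\<forall>f\<in>Arr C. \<forall>g\<in>Arr C. Cod C f = Cod C g \<longrightarrow> (\<exists>p q. is_pullback C f g p q))"

definition finitely_complete :: "('o, 'm, 'z) cat_scheme \<Rightarrow> bool" where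
  "finitely_complete C \<longleftrightarrow> (\<exists>t. is_terminal C t) \<and> has_pullbacks C"

definition is_coequalizer :: "('o, 'm, 'z) cat_scheme \<Rightarrow> 'm \<Rightarrow> 'm \<Rightarrow> 'm \<Rightarrow> bool" where
  "is_coequalizer C f g q \<longleftrightarrow>
     f \<in> Arr C \<and> g \<in> Arr C \<and> Dom C f = Dom C g \<and> Cod C f = Cod C g \<and>
     q \<in> Arr C \<and> Dom C q = Cod C f \<and> Comp C q f = Comp C q g \<and>
     (\<forall>x\<in>Obj C. \<forall>u\<in>homset C (Cod C f) x. Comp C u f = Comp C u g \<longrightarrow>
        (\<exists>!w. w \<in> homset C (Cod C q) x \<and> Comp C w q = u))"

definition regular_epi :: "('o, 'm, 'z) cat_scheme \<Rightarrow> 'm \<Rightarrow> bool" where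
  "regular_epi C q \<longleftrightarrow> (\<exists>f g. is_coequalizer C f g q)"

definition regular_category :: "('o, 'm, 'z) cat_scheme \<Rightarrow> bool" where
  "regular_category C \<longleftrightarrow> category C \<and> finitely_complete C \<and>
     (\<forall>f p q. is_pullback C f f p q \<longrightarrow> (\<exists>c. is_coequalizer C p q c)) \<and>
     (\<forall>f g p q. is_pullback C f g p q \<and> regular_epi C f \<longrightarrow> regular_epi C q)"

text \<open>An internal equivalence relation on \<open>Cod r = Cod s\<close> with projections \<open>r\<close>, \<open>s\<close>.\<close>

definition equivalence_relation :: "('o, 'm, 'z) cat_scheme \<Rightarrow> 'm \<Rightarrow> 'm \<Rightarrow> bool" where
  "equivalence_relation C r s \<longleftrightarrow>
     r \<in> Arr C \<and> s \<in> Arr C \<and> Dom C r = Dom C s \<and> Cod C r = Cod C s \<and>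
     (\<forall>x\<in>Obj C. \<forall>u\<in>homset C x (Dom C r). \<forall>v\<in>homset C x (Dom C r).
        Comp C r u = Comp C r v \<and> Comp C s u = Comp C s v \<longrightarrow> u = v) \<and>
     (\<exists>d\<in>homset C (Cod C r) (Dom C r).
        Comp C r d = Ident C (Cod C r) \<and> Comp C s d = Ident C (Cod C r)) \<and>
     (\<exists>t\<in>homset C (Dom C r) (Dom C r). Comp C r t = s \<and> Comp C s t = r) \<and>
     (\<forall>p q. is_pullback C s r p q \<longrightarrow>
        (\<exists>t\<in>homset C (Dom C p) (Dom C r).
           Comp C r t = Comp C r p \<and> Comp C s t = Comp C s q))"

definition barr_exact :: "('o, 'm, 'z) cat_scheme \<Rightarrow> bool" where
  "barr_exact C \<longleftrightarrow> regular_category C \<and>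
     (\<forall>r s. equivalence_relation C r s \<longrightarrow> (\<exists>f. is_pullback C f f r s))"

text \<open>
  Bourn protomodularity: pulling back points (split epimorphisms with a chosen section) along any
  \<open>v\<close> reflects isomorphisms. Here \<open>f\<close> is a morphism from the point \<open>(p, s)\<close> to the point
  \<open>(p', s')\<close>, and \<open>h\<close> is its image under the change-of-base functor of \<open>v\<close>.
\<close>

definition protomodular :: "('o, 'm, 'z) cat_scheme \<Rightarrow> bool" where
  "protomodular C \<longleftrightarrow> category C \<and> has_pullbacks C \<and>
     (\<forall>p s p' s' f v a x a' x' h.
        p \<in> Arr C \<and> s \<in> homset C (Cod C p) (Dom C p) \<and> Comp C p s = Ident C (Cod C p) \<and>
        p' \<in> Arr C \<and> s' \<in> homset C (Cod C p') (Dom C p') \<and> Comp C p' s' = Ident C (Cod C p') \<and>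
        Cod C p = Cod C p' \<and>
        f \<in> homset C (Dom C p) (Dom C p') \<and> Comp C p' f = p \<and> Comp C f s = s' \<and>
        is_pullback C p v a x \<and> is_pullback C p' v a' x' \<and>
        h \<in> homset C (Dom C a) (Dom C a') \<and> Comp C a' h = Comp C f a \<and> Comp C x' h = x \<and>
        is_iso C h \<longrightarrow> is_iso C f)"

definition semi_abelian_category :: "('o, 'm, 'z) cat_scheme \<Rightarrow> bool" where
  "semi_abelian_category C \<longleftrightarrow>
     barr_exact C \<and> protomodular C \<and> has_finite_coproducts C \<and> has_zero_object C"


section \<open>Algebraic theories and their algebras\<close>

text \<open>The object \<open>T\<^sup>n\<close> is the number \<open>n\<close>; \<open>Proj T n i\<close> is the \<open>i\<close>-th projection, \<open>i < n\<close>.\<close>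

record 'm alg_theory = "(nat, 'm) cat" +
  Proj :: "nat \<Rightarrow> nat \<Rightarrow> 'm"

definition algebraic_theory :: "'m alg_theory \<Rightarrow> bool" where
  "algebraic_theory T \<longleftrightarrow> category T \<and> Obj T = UNIV \<and>
     (\<forall>n. is_product T {..<n} (\<lambda>_. 1) n (Proj T n)) \<and> Proj T 1 0 = Ident T 1"

definition operations :: "'m alg_theory \<Rightarrow> nat \<Rightarrow> 'm set" where
  "operations T n = homset T n 1"

text \<open>
  \<open>A\<^sup>n\<close> is \<open>{..<n} \<rightarrow>\<^sub>E A\<close>. Values of the interpretation \<open>\<alpha>\<close> at arguments other than operations of
  \<open>T\<close> and tuples in \<open>A\<close> are irrelevant.
\<close>

definition t_algebra :: "'m alg_theory \<Rightarrow> 'a set \<Rightarrow> ('m \<Rightarrow> (nat \<Rightarrow> 'a) \<Rightarrow> 'a) \<Rightarrow> bool" where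
  "t_algebra T A \<alpha> \<longleftrightarrow>
     (\<forall>n. \<forall>\<tau>\<in>operations T n. \<alpha> \<tau> \<in> ({..<n} \<rightarrow>\<^sub>E A) \<rightarrow> A) \<and>
     (\<forall>n. \<forall>i<n. \<forall>x\<in>{..<n} \<rightarrow>\<^sub>E A. \<alpha> (Proj T n i) x = x i) \<and>
     (\<forall>m n. \<forall>\<tau>\<in>operations T n. \<forall>f\<in>homset T m n. \<forall>x\<in>{..<m} \<rightarrow>\<^sub>E A.
        \<alpha> (Comp T \<tau> f) x = \<alpha> \<tau> (\<lambda>i\<in>{..<n}. \<alpha> (Comp T (Proj T n i) f) x))"

definition t_homomorphism ::
  "'m alg_theory \<Rightarrow> 'a set \<Rightarrow> ('m \<Rightarrow> (nat \<Rightarrow> 'a) \<Rightarrow> 'a) \<Rightarrow>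
   'b set \<Rightarrow> ('m \<Rightarrow> (nat \<Rightarrow> 'b) \<Rightarrow> 'b) \<Rightarrow> ('a \<Rightarrow> 'b) \<Rightarrow> bool" where
  "t_homomorphism T A \<alpha> B \<beta> f \<longleftrightarrow> f \<in> A \<rightarrow> B \<and>
     (\<forall>n. \<forall>\<tau>\<in>operations T n. \<forall>x\<in>{..<n} \<rightarrow>\<^sub>E A. f (\<alpha> \<tau> x) = \<beta> \<tau> (\<lambda>i\<in>{..<n}. f (x i)))"

definition sub_t_algebra ::
  "'m alg_theory \<Rightarrow> 'a set \<Rightarrow> ('m \<Rightarrow> (nat \<Rightarrow> 'a) \<Rightarrow> 'a) \<Rightarrow> 'a set \<Rightarrow> bool" where
  "sub_t_algebra T A \<alpha> S \<longleftrightarrow> S \<subseteq> A \<and>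
     (\<forall>n. \<forall>\<tau>\<in>operations T n. \<forall>x\<in>{..<n} \<rightarrow>\<^sub>E S. \<alpha> \<tau> x \<in> S)"

text \<open>The value of a constant, i.e. of a \<open>0\<close>-ary operation at the empty tuple.\<close>

definition const_value :: "('m \<Rightarrow> (nat \<Rightarrow> 'a) \<Rightarrow> 'a) \<Rightarrow> 'm \<Rightarrow> 'a" where
  "const_value \<alpha> e = \<alpha> e (\<lambda>_. undefined)"

definition topological_t_algebra ::
  "'m alg_theory \<Rightarrow> 'a topology \<Rightarrow> ('m \<Rightarrow> (nat \<Rightarrow> 'a) \<Rightarrow> 'a) \<Rightarrow> bool" where
  "topological_t_algebra T X \<alpha> \<longleftrightarrow> t_algebra T (topspace X) \<alpha> \<and>
     (\<forall>n. \<forall>\<tau>\<in>operations T n. continuous_map (product_topology (\<lambda>_. X) {..<n}) X (\<alpha> \<tau>))"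

type_synonym ('m, 'u) alg = "'u set \<times> ('m \<Rightarrow> (nat \<Rightarrow> 'u) \<Rightarrow> 'u)"

text \<open>
  The category of \<open>T\<close>-algebras with carrier a set of elements of \<open>'u\<close>. Arrows are triples consisting
  of a domain, an extensional map and a codomain.
\<close>

definition algebra_category ::
  "'m alg_theory \<Rightarrow> (('m, 'u) alg, ('m, 'u) alg \<times> ('u \<Rightarrow> 'u) \<times> ('m, 'u) alg) cat" where
  "algebra_category T = \<lparr>
     Obj = {A. t_algebra T (fst A) (snd A)},
     Arr = {(A, f, B). t_algebra T (fst A) (snd A) \<and> t_algebra T (fst B) (snd B) \<and>
              f \<in> extensional (fst A) \<and> t_homomorphism T (fst A) (snd A) (fst B) (snd B) f},
     Dom = (\<lambda>(A, f, B). A),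
     Cod = (\<lambda>(A, f, B). B),
     Ident = (\<lambda>A. (A, \<lambda>x\<in>fst A. x, A)),
     Comp = (\<lambda>(B, g, D) (A, f, B'). (A, compose (fst A) g f, D)) \<rparr>"

text \<open>
  \<open>Set\<^sup>T\<close> is represented by the \<open>T\<close>-algebras whose carrier is a set of elements of the type \<open>'m\<close> of
  arrows of \<open>T\<close>. This type is infinite (the identities of the objects \<open>n\<close> are distinct) and contains
  all operations, so these algebras are, up to isomorphism, those of cardinality at most that of
  \<open>'m\<close>. They are closed under finite limits, quotients and finite coproducts and include all
  finitely generated free algebras.
\<close>

definition semi_abelian_theory :: "'m alg_theory \<Rightarrow> bool" where
  "semi_abelian_theory T \<longleftrightarrow> algebraic_theory T \<and>
     semi_abelian_category
       (algebra_category T :: (('m, 'm) alg, ('m, 'm) alg \<times> ('m \<Rightarrow> 'm) \<times> ('m, 'm) alg) cat)"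


section \<open>Fundamental groups\<close>

text \<open>
  A path is a function satisfying \<^const>\<open>pathin\<close>; its values outside \<open>[0, 1]\<close> are irrelevant. The
  library operations for joining and reversing paths require a type of class
  \<^class>\<open>topological_space\<close>, so they are restated here for abstract topologies.
\<close>

definition path_join :: "(real \<Rightarrow> 'a) \<Rightarrow> (real \<Rightarrow> 'a) \<Rightarrow> real \<Rightarrow> 'a" where
  "path_join \<beta> \<gamma> = (\<lambda>t. if t \<le> 1/2 then \<beta> (2 * t) else \<gamma> (2 * t - 1))"

definition path_reverse :: "(real \<Rightarrow> 'a) \<Rightarrow> real \<Rightarrow> 'a" where
  "path_reverse \<beta> = (\<lambda>t. \<beta> (1 - t))"

definition path_homotopic :: "'a topology \<Rightarrow> (real \<Rightarrow> 'a) \<Rightarrow> (real \<Rightarrow> 'a) \<Rightarrow> bool" where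
  "path_homotopic X \<beta> \<gamma> \<longleftrightarrow>
     homotopic_with (\<lambda>\<delta>. \<delta> 0 = \<beta> 0 \<and> \<delta> 1 = \<beta> 1) (top_of_set {0..1}) X \<beta> \<gamma>"

definition path_class :: "'a topology \<Rightarrow> (real \<Rightarrow> 'a) \<Rightarrow> (real \<Rightarrow> 'a) set" where
  "path_class X \<beta> = {\<gamma>. path_homotopic X \<beta> \<gamma>}"

definition based_paths :: "'a topology \<Rightarrow> 'a \<Rightarrow> (real \<Rightarrow> 'a) set" where
  "based_paths X x0 = {\<beta>. pathin X \<beta> \<and> \<beta> 0 = x0}"

definition loops :: "'a topology \<Rightarrow> 'a \<Rightarrow> (real \<Rightarrow> 'a) set" where
  "loops X x0 = {\<beta> \<in> based_paths X x0. \<beta> 1 = x0}"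

definition fundamental_group :: "'a topology \<Rightarrow> 'a \<Rightarrow> (real \<Rightarrow> 'a) set monoid" where
  "fundamental_group X x0 = \<lparr>
     carrier = path_class X ` loops X x0,
     monoid.mult = (\<lambda>P Q. \<Union>\<beta>\<in>P. \<Union>\<gamma>\<in>Q. path_class X (path_join \<beta> \<gamma>)),
     one = path_class X (\<lambda>_. x0) \<rparr>"

text \<open>The map of fundamental groups induced by \<open>f\<close>, sending the class of \<open>\<beta>\<close> to that of \<open>f \<circ> \<beta>\<close>.\<close>

definition induced_map :: "'b topology \<Rightarrow> ('a \<Rightarrow> 'b) \<Rightarrow> (real \<Rightarrow> 'a) set \<Rightarrow> (real \<Rightarrow> 'b) set" where
  "induced_map Y f P = (\<Union>\<beta>\<in>P. path_class Y (f \<circ> \<beta>))"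

definition subspace_pi1 :: "'a topology \<Rightarrow> 'a set \<Rightarrow> 'a \<Rightarrow> (real \<Rightarrow> 'a) set set" where
  "subspace_pi1 X S x0 = induced_map X (\<lambda>x. x) ` carrier (fundamental_group (subtopology X S) x0)"


section \<open>The space associated with a subgroup of the fundamental group\<close>

text \<open>In this section \<open>G\<close> is meant to be a subgroup of \<open>fundamental_group X x0\<close>.\<close>

definition cover_rel ::
  "'a topology \<Rightarrow> 'a \<Rightarrow> (real \<Rightarrow> 'a) set set \<Rightarrow> ((real \<Rightarrow> 'a) \<times> (real \<Rightarrow> 'a)) set" where
  "cover_rel X x0 G = {(\<beta>, \<gamma>). \<beta> \<in> based_paths X x0 \<and> \<gamma> \<in> based_paths X x0 \<and> \<beta> 1 = \<gamma> 1 \<and>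
     path_class X (path_join \<beta> (path_reverse \<gamma>)) \<in> G}"

definition cover_class ::
  "'a topology \<Rightarrow> 'a \<Rightarrow> (real \<Rightarrow> 'a) set set \<Rightarrow> (real \<Rightarrow> 'a) \<Rightarrow> (real \<Rightarrow> 'a) set" where
  "cover_class X x0 G \<beta> = cover_rel X x0 G `` {\<beta>}"

definition cover_set :: "'a topology \<Rightarrow> 'a \<Rightarrow> (real \<Rightarrow> 'a) set set \<Rightarrow> (real \<Rightarrow> 'a) set set" where
  "cover_set X x0 G = based_paths X x0 // cover_rel X x0 G"

definition cover_nbhd ::
  "'a topology \<Rightarrow> 'a \<Rightarrow> (real \<Rightarrow> 'a) set set \<Rightarrow> (real \<Rightarrow> 'a) \<Rightarrow> 'a set \<Rightarrow> (real \<Rightarrow> 'a) set set" where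
  "cover_nbhd X x0 G \<beta> U =
     {cover_class X x0 G (path_join \<beta> l) | l. pathin (subtopology X U) l \<and> l 0 = \<beta> 1}"

definition cover_topology ::
  "'a topology \<Rightarrow> 'a \<Rightarrow> (real \<Rightarrow> 'a) set set \<Rightarrow> (real \<Rightarrow> 'a) set topology" where
  "cover_topology X x0 G = topology_generated_by
     {cover_nbhd X x0 G \<beta> U | \<beta> U. \<beta> \<in> based_paths X x0 \<and> openin X U \<and> \<beta> 1 \<in> U}"

text \<open>The common end point of the paths in a class.\<close>

definition cover_proj :: "(real \<Rightarrow> 'a) set \<Rightarrow> 'a" where
  "cover_proj c = the_elem ((\<lambda>\<beta>. \<beta> 1) ` c)"

end

theory Submission
  imports Defs
begin

text \<open>
  Pointwise application of an operation \<open>\<tau>\<close> of a topological algebra \<open>A\<close> to paths commutes with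
  concatenation and sends homotopies to homotopies, since \<open>\<tau>\<close> is continuous. The only condition
  that is not automatic is the base point: the result starts at \<open>e\<close> only if \<open>\<tau>(e, \<dots>, e) = e\<close>. Now
  \<open>\<tau>(e, \<dots>, e)\<close> is the value of a constant of the theory, so it suffices that the theory has only
  one constant. This follows from the existence of a zero algebra \<open>Z\<close>: the free algebra on no
  generators is the set of all constants of the theory; the homomorphism from \<open>Z\<close> to it recovers a
  constant from its value in \<open>Z\<close>, while the homomorphism from the one-element algebra to \<open>Z\<close> shows
  that all constants have the same value there.

  Next, the relation \<open>\<beta> \<simeq> \<gamma>\<close> is put in a form that operations visibly respect. As \<open>B\<close> consists of the
  classes of loops in the subalgebra \<open>A'\<close>, it says that \<open>\<beta>\<close> is homotopic, with fixed end points, to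
  \<open>l \<circ> \<gamma>\<close> (first \<open>l\<close>, then \<open>\<gamma>\<close>) for a loop \<open>l\<close> in \<open>A'\<close> (lemma \<open>cover_rel_iff\<close>). If \<open>\<beta>\<^sub>i\<close> is homotopic to \<open>l\<^sub>i \<circ> \<gamma>\<^sub>i\<close> for all
  \<open>i\<close>, then \<open>\<tau>(\<beta>\<^sub>1, \<dots>, \<beta>\<^sub>n)\<close> is homotopic to \<open>\<tau>(l\<^sub>1, \<dots>, l\<^sub>n) \<circ> \<tau>(\<gamma>\<^sub>1, \<dots>, \<gamma>\<^sub>n)\<close>, and the first factor is a
  loop in \<open>A'\<close> because \<open>A'\<close> is closed under \<open>\<tau>\<close> (lemma \<open>cls_pointwise_op_cong\<close>). So \<open>\<tau>\<close> acts on
  classes, and the laws of an algebra, which hold at each parameter of the paths, carry over.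

  For continuity, a basic neighbourhood may be recentred at each of its points (lemma
  \<open>nbhd_recentre_subset\<close>), so it is enough to find a neighbourhood of \<open>(\<langle>\<beta>\<^sub>1\<rangle>, \<dots>, \<langle>\<beta>\<^sub>n\<rangle>)\<close> that \<open>\<tau>\<close> maps into
  \<open>(\<langle>\<tau>(\<beta>\<^sub>1, \<dots>, \<beta>\<^sub>n)\<rangle>, U)\<close>. Continuity of \<open>\<tau>\<close> on \<open>A\<close> gives open \<open>V\<^sub>i\<close> around \<open>\<beta>\<^sub>i(1)\<close> with
  \<open>\<tau>(V\<^sub>1 \<times> \<dots> \<times> V\<^sub>n) \<subseteq> U\<close>, and \<open>\<tau>(\<beta>\<^sub>1 \<circ> l\<^sub>1, \<dots>, \<beta>\<^sub>n \<circ> l\<^sub>n) = \<tau>(\<beta>\<^sub>1, \<dots>, \<beta>\<^sub>n) \<circ> \<tau>(l\<^sub>1, \<dots>, l\<^sub>n)\<close> for paths \<open>l\<^sub>i\<close> in \<open>V\<^sub>i\<close>.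
\<close>

section \<open>Homotopies of paths in an abstract topological space\<close>

lemma unit_square:
  "prod_topology (top_of_set {0..1::real}) (top_of_set {0..1::real}) = top_of_set ({0..1} \<times> {0..1})"
  by (simp add: subtopology_Times[symmetric] euclidean_product_topology)

text \<open>
  All conditions are imposed at parameters in \<open>[0, 1]\<close> only, so the values of the paths elsewhere do
  not matter.
\<close>

lemma path_homotopic_iff:
  "path_homotopic X \<beta> \<gamma> \<longleftrightarrow>
     (\<exists>h. continuous_map (top_of_set ({0..1::real} \<times> {0..1})) X h \<and>
          (\<forall>t\<in>{0..1}. h (0, t) = \<beta> t \<and> h (1, t) = \<gamma> t) \<and>
          (\<forall>s\<in>{0..1::real}. h (s, 0) = \<beta> 0 \<and> h (s, 1) = \<beta> 1))"
  unfolding path_homotopic_def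
  by (subst homotopic_with) (simp_all add: unit_square ball_conj_distrib conj_assoc)

lemma path_homotopic_endpoints:
  assumes "path_homotopic X \<beta> \<gamma>"
  shows "\<gamma> 0 = \<beta> 0" "\<gamma> 1 = \<beta> 1"
  using assms unfolding path_homotopic_def by (auto dest: homotopic_with_imp_property)

lemma path_homotopic_imp_pathin:
  assumes "path_homotopic X \<beta> \<gamma>"
  shows "pathin X \<beta>" "pathin X \<gamma>"
  using homotopic_with_imp_continuous_maps[OF assms[unfolded path_homotopic_def]]
  by (auto simp: pathin_def)

lemma path_homotopic_cong:
  assumes "pathin X \<beta>" and "\<And>t. t \<in> {0..1} \<Longrightarrow> \<gamma> t = \<beta> t"
  shows "path_homotopic X \<beta> \<gamma>"
  unfolding path_homotopic_def
  by (rule homotopic_with_equal) (use assms in \<open>auto simp: pathin_def\<close>)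

lemma path_homotopic_refl: "pathin X \<beta> \<Longrightarrow> path_homotopic X \<beta> \<beta>"
  by (rule path_homotopic_cong) simp_all

lemma path_homotopic_sym:
  assumes "path_homotopic X \<beta> \<gamma>"
  shows "path_homotopic X \<gamma> \<beta>"
  using homotopic_with_symD[OF assms[unfolded path_homotopic_def]] path_homotopic_endpoints[OF assms]
  by (simp add: path_homotopic_def)

lemma path_homotopic_trans [trans]:
  assumes "path_homotopic X \<beta> \<gamma>" "path_homotopic X \<gamma> \<delta>"
  shows "path_homotopic X \<beta> \<delta>"
proof -
  have "homotopic_with (\<lambda>\<eta>. \<eta> 0 = \<beta> 0 \<and> \<eta> 1 = \<beta> 1) (top_of_set {0..1}) X \<gamma> \<delta>"
    using assms(2) path_homotopic_endpoints[OF assms(1)] by (simp add: path_homotopic_def)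
  with assms(1) show ?thesis
    unfolding path_homotopic_def by (rule homotopic_with_trans)
qed

lemma path_homotopic_mono:
  assumes "path_homotopic (subtopology X S) \<beta> \<gamma>"
  shows "path_homotopic X \<beta> \<gamma>"
  using assms unfolding path_homotopic_iff by (meson continuous_map_into_fulltopology)

lemma path_class_eq_iff:
  assumes "pathin X \<delta>"
  shows "path_class X \<beta> = path_class X \<delta> \<longleftrightarrow> path_homotopic X \<beta> \<delta>"
proof
  assume "path_class X \<beta> = path_class X \<delta>"
  then show "path_homotopic X \<beta> \<delta>"
    using path_homotopic_refl[OF assms] by (auto simp: path_class_def)
next
  assume *: "path_homotopic X \<beta> \<delta>"
  show "path_class X \<beta> = path_class X \<delta>"
    unfolding path_class_def
    by (intro Collect_cong iffI; erule path_homotopic_trans[OF *] path_homotopic_trans[OF path_homotopic_sym[OF *]])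
qed

text \<open>
  Two maps of the unit interval with the same end points are joined by a straight-line homotopy.
  The associativity, unit and inverse laws for concatenation below are all instances: in each of
  them both sides run along one path, at different speeds.
\<close>

lemma path_homotopic_reparam:
  fixes \<phi> \<psi> :: "real \<Rightarrow> real"
  assumes \<beta>: "pathin X \<beta>"
    and \<phi>: "continuous_on {0..1} \<phi>" "\<phi> \<in> {0..1} \<rightarrow> {0..1}"
    and \<psi>: "continuous_on {0..1} \<psi>" "\<psi> \<in> {0..1} \<rightarrow> {0..1}"
    and ends: "\<phi> 0 = \<psi> 0" "\<phi> 1 = \<psi> 1"
  shows "path_homotopic X (\<lambda>t. \<beta> (\<phi> t)) (\<lambda>t. \<beta> (\<psi> t))"
proof -
  define k where "k = (\<lambda>(s, t). (1 - s) * \<phi> t + s * \<psi> t)"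
  have "continuous_on ({0..1} \<times> {0..1}) k"
    unfolding k_def case_prod_unfold
    by (intro continuous_intros continuous_on_compose2[OF \<phi>(1)] continuous_on_compose2[OF \<psi>(1)]) auto
  moreover have "k \<in> {0..1} \<times> {0..1} \<rightarrow> {0..1}"
  proof
    fix z :: "real \<times> real" assume "z \<in> {0..1} \<times> {0..1}"
    then obtain s t where z: "z = (s, t)" "s \<in> {0..1}" "t \<in> {0..1}" by auto
    have "(1 - s) *\<^sub>R \<phi> t + s *\<^sub>R \<psi> t \<in> {0..1}"
      by (rule convexD[OF convex_closed_interval[of 0 1, unfolded cbox_interval]])
         (use z \<phi>(2) \<psi>(2) in auto)
    then show "k z \<in> {0..1}" by (simp add: k_def z)
  qed
  ultimately have "continuous_map (top_of_set ({0..1} \<times> {0..1})) (top_of_set {0..1}) k"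
    by (auto simp: continuous_map_in_subtopology)
  then have "continuous_map (top_of_set ({0..1} \<times> {0..1})) X (\<beta> \<circ> k)"
    using \<beta> unfolding pathin_def by (rule continuous_map_compose)
  then show ?thesis
    unfolding path_homotopic_iff using ends
    by (intro exI[of _ "\<beta> \<circ> k"]) (auto simp: k_def algebra_simps)
qed

lemma path_join_0 [simp]: "path_join \<beta> \<gamma> 0 = \<beta> 0"
  and path_join_1 [simp]: "path_join \<beta> \<gamma> 1 = \<gamma> 1"
  by (simp_all add: path_join_def)

lemma path_reverse_0 [simp]: "path_reverse \<beta> 0 = \<beta> 1"
  and path_reverse_1 [simp]: "path_reverse \<beta> 1 = \<beta> 0"
  by (simp_all add: path_reverse_def)

lemma pathin_reverse:
  assumes "pathin X \<beta>"
  shows "pathin X (path_reverse \<beta>)"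
proof -
  have "continuous_map (top_of_set {0..1}) (top_of_set {0..1}) (\<lambda>t::real. 1 - t)"
    by (auto simp: continuous_map_in_subtopology intro!: continuous_intros)
  then show ?thesis
    using continuous_map_compose assms unfolding pathin_def path_reverse_def comp_def by blast
qed

lemma path_homotopic_join:
  assumes "path_homotopic X \<beta> \<beta>'" "path_homotopic X \<gamma> \<gamma>'" and ends: "\<beta> 1 = \<gamma> 0"
  shows "path_homotopic X (path_join \<beta> \<gamma>) (path_join \<beta>' \<gamma>')"
proof -
  let ?Q = "{0..1} \<times> {0..1} :: (real \<times> real) set"
  obtain h where h: "continuous_map (top_of_set ?Q) X h"
      "\<forall>t\<in>{0..1}. h (0, t) = \<beta> t \<and> h (1, t) = \<beta>' t"
      "\<forall>s\<in>{0..1}. h (s, 0) = \<beta> 0 \<and> h (s, 1) = \<beta> 1"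
    using assms(1) unfolding path_homotopic_iff by blast
  obtain k where k: "continuous_map (top_of_set ?Q) X k"
      "\<forall>t\<in>{0..1}. k (0, t) = \<gamma> t \<and> k (1, t) = \<gamma>' t"
      "\<forall>s\<in>{0..1}. k (s, 0) = \<gamma> 0 \<and> k (s, 1) = \<gamma> 1"
    using assms(2) unfolding path_homotopic_iff by blast
  define H where "H = (\<lambda>z::real \<times> real. if snd z \<le> 1/2 then (h \<circ> (\<lambda>z. (fst z, 2 * snd z))) z
                            else (k \<circ> (\<lambda>z. (fst z, 2 * snd z - 1))) z)"
  have "continuous_map (top_of_set ?Q) X H"
    unfolding H_def
  proof (rule continuous_map_cases_le)
    show "continuous_map (subtopology (top_of_set ?Q) {x \<in> topspace (top_of_set ?Q). snd x \<le> 1/2}) X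
            (h \<circ> (\<lambda>z. (fst z, 2 * snd z)))"
      by (rule continuous_map_compose[OF _ h(1)])
         (auto simp: continuous_map_in_subtopology subtopology_subtopology intro!: continuous_intros)
    show "continuous_map (subtopology (top_of_set ?Q) {x \<in> topspace (top_of_set ?Q). 1/2 \<le> snd x}) X
            (k \<circ> (\<lambda>z. (fst z, 2 * snd z - 1)))"
      by (rule continuous_map_compose[OF _ k(1)])
         (auto simp: continuous_map_in_subtopology subtopology_subtopology intro!: continuous_intros)
    show "(h \<circ> (\<lambda>z. (fst z, 2 * snd z))) x = (k \<circ> (\<lambda>z. (fst z, 2 * snd z - 1))) x"
      if "x \<in> topspace (top_of_set ?Q)" "snd x = 1/2" for x
    proof -
      have "2 * snd x = 1" "2 * snd x - 1 = 0" "fst x \<in> {0..1}"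
        using that by auto
      then show ?thesis
        using h(3) k(3) ends by simp
    qed
  qed (auto intro!: continuous_intros)
  moreover have "\<forall>t\<in>{0..1}. H (0, t) = path_join \<beta> \<gamma> t \<and> H (1, t) = path_join \<beta>' \<gamma>' t"
    using h(2) k(2) by (auto simp: H_def path_join_def)
  moreover have "\<forall>s\<in>{0..1}. H (s, 0) = path_join \<beta> \<gamma> 0 \<and> H (s, 1) = path_join \<beta> \<gamma> 1"
    using h(3) k(3) by (auto simp: H_def path_join_def)
  ultimately show ?thesis unfolding path_homotopic_iff by blast
qed

lemma pathin_join:
  assumes "pathin X \<beta>" "pathin X \<gamma>" "\<beta> 1 = \<gamma> 0"
  shows "pathin X (path_join \<beta> \<gamma>)"
  using path_homotopic_imp_pathin(1)[OF path_homotopic_join[OF path_homotopic_refl path_homotopic_refl]] assms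
  by blast

lemma path_homotopic_assoc:
  assumes "pathin X \<beta>" "pathin X \<gamma>" "pathin X \<delta>" "\<beta> 1 = \<gamma> 0" "\<gamma> 1 = \<delta> 0"
  shows "path_homotopic X (path_join (path_join \<beta> \<gamma>) \<delta>) (path_join \<beta> (path_join \<gamma> \<delta>))"
proof -
  (* phi maps the intervals [0,1/4], [1/4,1/2], [1/2,1], which the left-nested concatenation
     spends on the three paths, onto [0,1/2], [1/2,3/4], [3/4,1]. *)
  define \<phi> :: "real \<Rightarrow> real"
    where "\<phi> t = (if t \<le> 1/2 then if t \<le> 1/4 then 2 * t else t + 1/4 else (t + 1)/2)" for t
  (* The three pieces have slopes 2, 1, 1/2, so phi is concave and is the minimum of the three
     affine functions; this gives continuity. *)
  have \<phi>_min: "\<phi> = (\<lambda>t. min (min (2 * t) (t + 1/4)) ((t + 1)/2))"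
    by (rule ext) (auto simp: \<phi>_def min_def)
  have "pathin X (path_join \<beta> (path_join \<gamma> \<delta>))"
    using assms by (intro pathin_join) auto
  then have "path_homotopic X (\<lambda>t. path_join \<beta> (path_join \<gamma> \<delta>) (\<phi> t)) (path_join \<beta> (path_join \<gamma> \<delta>))"
  proof (rule path_homotopic_reparam)
    show "continuous_on {0..1} \<phi>"
      unfolding \<phi>_min by (intro continuous_intros) simp_all
  qed (auto simp: \<phi>_def)
  also have "(\<lambda>t. path_join \<beta> (path_join \<gamma> \<delta>) (\<phi> t)) = path_join (path_join \<beta> \<gamma>) \<delta>"
    using assms by (intro ext) (auto simp: \<phi>_def path_join_def algebra_simps add_divide_distrib)
  finally show ?thesis .
qed

lemma path_homotopic_left_unit:
  assumes "pathin X \<beta>" "\<beta> 0 = x"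
  shows "path_homotopic X (path_join (\<lambda>_. x) \<beta>) \<beta>"
proof -
  have "path_homotopic X (\<lambda>t. \<beta> (max 0 (2 * t - 1))) \<beta>"
    by (rule path_homotopic_reparam[OF assms(1)]) (auto intro!: continuous_intros)
  also have "(\<lambda>t. \<beta> (max 0 (2 * t - 1))) = path_join (\<lambda>_. x) \<beta>"
    
  proof
    fix t :: real
    show "\<beta> (max 0 (2 * t - 1)) = path_join (\<lambda>_. x) \<beta> t"
      using assms by (cases t "1/2 :: real" rule: linorder_cases) (auto simp: path_join_def)
  qed
  finally show ?thesis .
qed

lemma path_homotopic_right_unit:
  assumes "pathin X \<beta>" "\<beta> 1 = x"
  shows "path_homotopic X (path_join \<beta> (\<lambda>_. x)) \<beta>"
proof -
  have "path_homotopic X (\<lambda>t. \<beta> (min 1 (2 * t))) \<beta>"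
    by (rule path_homotopic_reparam[OF assms(1)]) (auto intro!: continuous_intros)
  also have "(\<lambda>t. \<beta> (min 1 (2 * t))) = path_join \<beta> (\<lambda>_. x)"
    
  proof
    fix t :: real
    have "\<beta> (2 * t) = x" if "2 * t = 1"
      unfolding that by (rule assms)
    then show "\<beta> (min 1 (2 * t)) = path_join \<beta> (\<lambda>_. x) t"
      using assms by (cases "2 * t" "1 :: real" rule: linorder_cases) (auto simp: path_join_def)
  qed
  finally show ?thesis .
qed

text \<open>
  The path \<open>\<beta>\<close> followed by its reverse is \<open>\<beta>\<close> precomposed with a tent function, whose end points
  are both \<open>0\<close>.
\<close>

lemma path_homotopic_right_inverse:
  assumes "pathin X \<beta>"
  shows "path_homotopic X (path_join \<beta> (path_reverse \<beta>)) (\<lambda>_. \<beta> 0)"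
proof -
  have "path_homotopic X (\<lambda>t. \<beta> (min (2 * t) (2 - 2 * t))) (\<lambda>_. \<beta> 0)"
  proof (rule path_homotopic_reparam[OF assms])
    show "continuous_on {0..1} (\<lambda>t::real. min (2 * t) (2 - 2 * t))"
      by (intro continuous_intros)
  qed (auto simp: min_def)
  also have "(\<lambda>t. \<beta> (min (2 * t) (2 - 2 * t))) = path_join \<beta> (path_reverse \<beta>)"
    by (auto simp: path_join_def path_reverse_def min_def fun_eq_iff)
  finally show ?thesis .
qed

lemma path_homotopic_left_inverse:
  assumes "pathin X \<beta>"
  shows "path_homotopic X (path_join (path_reverse \<beta>) \<beta>) (\<lambda>_. \<beta> 1)"
  using path_homotopic_right_inverse[OF pathin_reverse[OF assms]]
  by (simp add: path_reverse_def)

section \<open>The space of classes of paths modulo loops in a subspace\<close>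

lemma based_pathsD: "\<beta> \<in> based_paths X x0 \<Longrightarrow> pathin X \<beta>" "\<beta> \<in> based_paths X x0 \<Longrightarrow> \<beta> 0 = x0"
  by (auto simp: based_paths_def)

lemma based_paths_in_topspace:
  assumes "t \<in> {0..1}" "\<beta> \<in> based_paths X x0"
  shows "\<beta> t \<in> topspace X"
  using assms by (auto simp: based_paths_def pathin_def continuous_map_def)

lemma path_join_in_based_paths:
  assumes "\<beta> \<in> based_paths X x0" "pathin X l" "l 0 = \<beta> 1"
  shows "path_join \<beta> l \<in> based_paths X x0"
  using assms by (auto simp: based_paths_def pathin_join)

lemma loops_subtopologyD:
  assumes "l \<in> loops (subtopology X S) x0"
  shows "pathin X l" "l 0 = x0" "l 1 = x0"
  using assms
  by (auto simp: loops_def based_paths_def pathin_def continuous_map_in_subtopology)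

lemma path_join_in_loops:
  assumes "l \<in> loops X x0" "m \<in> loops X x0"
  shows "path_join l m \<in> loops X x0"
  using assms by (auto simp: loops_def based_paths_def pathin_join)

lemma path_reverse_in_loops:
  assumes "l \<in> loops X x0"
  shows "path_reverse l \<in> loops X x0"
  using assms by (auto simp: loops_def based_paths_def pathin_reverse)

lemma const_in_loops: "x0 \<in> topspace X \<Longrightarrow> (\<lambda>_. x0) \<in> loops X x0"
  by (auto simp: loops_def based_paths_def pathin_def)

text \<open>
  A homotopy in the subspace is one in the whole space, so the union in \<^const>\<open>induced_map\<close> is over
  equal classes.
\<close>

lemma subspace_pi1_eq:
  "subspace_pi1 X S x0 = path_class X ` loops (subtopology X S) x0"
proof -
  have "induced_map X (\<lambda>x. x) (path_class (subtopology X S) l) = path_class X l"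
    if "l \<in> loops (subtopology X S) x0" for l
  proof -
    let ?L = "path_class (subtopology X S) l"
    have l: "pathin (subtopology X S) l"
      using that by (auto simp: loops_def based_paths_def)
    have "path_class X ((\<lambda>x. x) \<circ> m) = path_class X l" if "m \<in> ?L" for m
    proof -
      have "path_homotopic X l m"
        using that path_homotopic_mono by (auto simp: path_class_def)
      then have "path_class X l = path_class X m"
        by (simp add: path_class_eq_iff path_homotopic_imp_pathin)
      then show ?thesis by (simp add: comp_def)
    qed
    moreover have "l \<in> ?L"
      using path_homotopic_refl[OF l] by (simp add: path_class_def)
    ultimately show ?thesis
      unfolding induced_map_def by blast
  qed
  then show ?thesis
    by (simp add: subspace_pi1_def fundamental_group_def image_image)
qed

text \<open>
  The construction is studied for those subgroups of the fundamental group of \<open>X\<close> that come from a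
  subspace; membership in such a subgroup is witnessed by loops in the subspace.
\<close>

locale path_space_mod_subspace =
  fixes X :: "'a topology" and S :: "'a set" and x0 :: 'a
  assumes S_subset: "S \<subseteq> topspace X" and x0_in_S: "x0 \<in> S"
begin

abbreviation P :: "(real \<Rightarrow> 'a) set" where "P \<equiv> based_paths X x0"
abbreviation L :: "(real \<Rightarrow> 'a) set" where "L \<equiv> loops (subtopology X S) x0"
abbreviation G :: "(real \<Rightarrow> 'a) set set" where "G \<equiv> subspace_pi1 X S x0"
abbreviation cls :: "(real \<Rightarrow> 'a) \<Rightarrow> (real \<Rightarrow> 'a) set" where "cls \<equiv> cover_class X x0 G"
abbreviation nbhd :: "(real \<Rightarrow> 'a) \<Rightarrow> 'a set \<Rightarrow> (real \<Rightarrow> 'a) set set" where "nbhd \<equiv> cover_nbhd X x0 G"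
abbreviation XG :: "(real \<Rightarrow> 'a) set topology" where "XG \<equiv> cover_topology X x0 G"

lemma x0_in_X: "x0 \<in> topspace X"
  using S_subset x0_in_S by blast

lemma const_in_L: "(\<lambda>_. x0) \<in> L"
  using S_subset x0_in_S by (intro const_in_loops) auto

lemma const_in_P: "(\<lambda>_. x0) \<in> P"
  using const_in_loops[OF x0_in_X] by (simp add: loops_def)

text \<open>
  Two paths are identified iff they differ, up to homotopy, by a loop in \<open>S\<close> inserted at the start.
  This form is the useful one because prefixing a loop is compatible with concatenation on the right
  and with pointwise operations.
\<close>

lemma cover_rel_iff:
  "(\<beta>, \<gamma>) \<in> cover_rel X x0 G \<longleftrightarrow>
     \<beta> \<in> P \<and> \<gamma> \<in> P \<and> (\<exists>l\<in>L. path_homotopic X \<beta> (path_join l \<gamma>))"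
proof (intro iffI conjI; (elim conjE)?)
  assume rel: "(\<beta>, \<gamma>) \<in> cover_rel X x0 G"
  then show \<beta>: "\<beta> \<in> P" and \<gamma>: "\<gamma> \<in> P"
    by (auto simp: cover_rel_def)
  obtain l where l: "l \<in> L" "path_class X (path_join \<beta> (path_reverse \<gamma>)) = path_class X l"
    and ends: "\<beta> 1 = \<gamma> 1"
    using rel by (auto simp: cover_rel_def subspace_pi1_eq)
  note b = based_pathsD[OF \<beta>] and c = based_pathsD[OF \<gamma>] and l' = loops_subtopologyD[OF l(1)]
  have \<beta>\<gamma>: "path_homotopic X (path_join \<beta> (path_reverse \<gamma>)) l"
    using l(2) l' by (simp add: path_class_eq_iff)
  have "path_homotopic X \<beta> (path_join \<beta> (\<lambda>_. \<beta> 1))"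
    by (intro path_homotopic_sym[OF path_homotopic_right_unit] b refl)
  also have "path_homotopic X \<dots> (path_join \<beta> (path_join (path_reverse \<gamma>) \<gamma>))"
    unfolding ends
    by (intro path_homotopic_join path_homotopic_refl b
        path_homotopic_sym[OF path_homotopic_left_inverse] c ends)
  also have "path_homotopic X \<dots> (path_join (path_join \<beta> (path_reverse \<gamma>)) \<gamma>)"
    by (intro path_homotopic_sym[OF path_homotopic_assoc] b c pathin_reverse) (simp_all add: ends)
  also have "path_homotopic X \<dots> (path_join l \<gamma>)"
    by (intro path_homotopic_join \<beta>\<gamma> path_homotopic_refl c) simp
  finally show "\<exists>l\<in>L. path_homotopic X \<beta> (path_join l \<gamma>)"
    using l(1) by blast
next
  assume \<beta>: "\<beta> \<in> P" and \<gamma>: "\<gamma> \<in> P" and "\<exists>l\<in>L. path_homotopic X \<beta> (path_join l \<gamma>)"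
  then obtain l where l: "l \<in> L" and hom: "path_homotopic X \<beta> (path_join l \<gamma>)" by blast
  note b = based_pathsD[OF \<beta>] and c = based_pathsD[OF \<gamma>] and l' = loops_subtopologyD[OF l]
  have ends: "\<beta> 1 = \<gamma> 1"
    using path_homotopic_endpoints(2)[OF hom] by simp
  have "path_homotopic X (path_join \<beta> (path_reverse \<gamma>)) (path_join (path_join l \<gamma>) (path_reverse \<gamma>))"
    by (intro path_homotopic_join hom path_homotopic_refl pathin_reverse c) (simp add: ends)
  also have "path_homotopic X \<dots> (path_join l (path_join \<gamma> (path_reverse \<gamma>)))"
    by (intro path_homotopic_assoc l' c pathin_reverse) (simp_all add: l' c)
  also have "path_homotopic X \<dots> (path_join l (\<lambda>_. \<gamma> 0))"
    by (intro path_homotopic_join path_homotopic_refl l' path_homotopic_right_inverse c)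
       (simp add: l' c)
  also have "path_homotopic X \<dots> l"
    by (intro path_homotopic_right_unit l') (simp add: l' c)
  finally have "path_class X (path_join \<beta> (path_reverse \<gamma>)) = path_class X l"
    by (simp add: path_class_eq_iff l')
  then show "(\<beta>, \<gamma>) \<in> cover_rel X x0 G"
    using \<beta> \<gamma> ends l by (auto simp: cover_rel_def subspace_pi1_eq)
qed

lemma equiv_cover_rel: "equiv P (cover_rel X x0 G)"
proof (rule equivI)
  show "cover_rel X x0 G \<subseteq> P \<times> P"
    by (auto simp: cover_rel_def)
  show "refl_on P (cover_rel X x0 G)"
  proof (rule refl_onI)
    fix \<beta> assume \<beta>: "\<beta> \<in> P"
    then have "path_homotopic X \<beta> (path_join (\<lambda>_. x0) \<beta>)"
      by (intro path_homotopic_sym[OF path_homotopic_left_unit] based_pathsD)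
    then show "(\<beta>, \<beta>) \<in> cover_rel X x0 G"
      unfolding cover_rel_iff using \<beta> const_in_L by blast
  qed
  show "sym (cover_rel X x0 G)"
  proof (rule symI)
    fix \<beta> \<gamma> assume "(\<beta>, \<gamma>) \<in> cover_rel X x0 G"
    then obtain l where \<beta>: "\<beta> \<in> P" and \<gamma>: "\<gamma> \<in> P" and l: "l \<in> L"
      and hom: "path_homotopic X \<beta> (path_join l \<gamma>)"
      unfolding cover_rel_iff by blast
    note b = based_pathsD[OF \<beta>] and c = based_pathsD[OF \<gamma>] and l' = loops_subtopologyD[OF l]
    have "path_homotopic X \<gamma> (path_join (\<lambda>_. l 1) \<gamma>)"
      by (intro path_homotopic_sym[OF path_homotopic_left_unit] c) (simp add: l' c)
    also have "path_homotopic X \<dots> (path_join (path_join (path_reverse l) l) \<gamma>)"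
      by (intro path_homotopic_join path_homotopic_sym[OF path_homotopic_left_inverse]
          path_homotopic_refl c l') (simp add: l' c)
    also have "path_homotopic X \<dots> (path_join (path_reverse l) (path_join l \<gamma>))"
      by (intro path_homotopic_assoc pathin_reverse l' c) (simp_all add: l' c)
    also have "path_homotopic X \<dots> (path_join (path_reverse l) \<beta>)"
      by (intro path_homotopic_join path_homotopic_refl pathin_reverse l' path_homotopic_sym[OF hom])
         simp
    finally show "(\<gamma>, \<beta>) \<in> cover_rel X x0 G"
      unfolding cover_rel_iff using \<beta> \<gamma> path_reverse_in_loops[OF l] by blast
  qed
  show "trans (cover_rel X x0 G)"
  proof (rule transI)
    fix \<beta> \<gamma> \<delta>
    assume "(\<beta>, \<gamma>) \<in> cover_rel X x0 G" "(\<gamma>, \<delta>) \<in> cover_rel X x0 G"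
    then obtain l m where \<beta>: "\<beta> \<in> P" and \<gamma>: "\<gamma> \<in> P" and \<delta>: "\<delta> \<in> P" and l: "l \<in> L" and m: "m \<in> L"
      and hom: "path_homotopic X \<beta> (path_join l \<gamma>)" "path_homotopic X \<gamma> (path_join m \<delta>)"
      unfolding cover_rel_iff by blast
    note c = based_pathsD[OF \<gamma>] and d = based_pathsD[OF \<delta>]
      and l' = loops_subtopologyD[OF l] and m' = loops_subtopologyD[OF m]
    note hom(1)
    also have "path_homotopic X (path_join l \<gamma>) (path_join l (path_join m \<delta>))"
      by (intro path_homotopic_join path_homotopic_refl l' hom(2)) (simp add: l' c)
    also have "path_homotopic X \<dots> (path_join (path_join l m) \<delta>)"
      by (intro path_homotopic_sym[OF path_homotopic_assoc] l' m' d) (simp_all add: l' m' d)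
    finally show "(\<beta>, \<delta>) \<in> cover_rel X x0 G"
      unfolding cover_rel_iff using \<beta> \<delta> path_join_in_loops[OF l m] by blast
  qed
qed

lemma cls_eq_iff:
  assumes "\<beta> \<in> P" "\<gamma> \<in> P"
  shows "cls \<beta> = cls \<gamma> \<longleftrightarrow> (\<exists>l\<in>L. path_homotopic X \<beta> (path_join l \<gamma>))"
  unfolding cover_class_def eq_equiv_class_iff[OF equiv_cover_rel assms] cover_rel_iff
  using assms by simp

lemma cls_eqI:
  assumes "\<beta> \<in> P" "\<gamma> \<in> P" and "path_homotopic X \<beta> \<gamma>"
  shows "cls \<beta> = cls \<gamma>"
proof -
  have "path_homotopic X \<gamma> (path_join (\<lambda>_. x0) \<gamma>)"
    using assms by (intro path_homotopic_sym[OF path_homotopic_left_unit] based_pathsD)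
  then show ?thesis
    using cls_eq_iff[OF assms(1,2)] const_in_L path_homotopic_trans[OF assms(3)] by blast
qed

text \<open>
  The laws of an algebra apply to the values of paths only at parameters in \<open>[0, 1]\<close>, where these
  values lie in \<open>X\<close>; this lemma turns such pointwise laws into equalities of classes.
\<close>

lemma cls_cong:
  assumes "\<beta> \<in> P" and "\<And>t. t \<in> {0..1} \<Longrightarrow> \<gamma> t = \<beta> t"
  shows "cls \<gamma> = cls \<beta>"
proof -
  have hom: "path_homotopic X \<beta> \<gamma>"
    using assms by (intro path_homotopic_cong based_pathsD(1))
  then have "\<gamma> \<in> P"
    using assms path_homotopic_imp_pathin(2)[OF hom] by (simp add: based_paths_def)
  then show ?thesis
    using cls_eqI[OF assms(1) _ hom] by simp
qed

lemma cls_eq_imp_end_eq: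
  assumes "\<beta> \<in> P" "\<gamma> \<in> P" "cls \<beta> = cls \<gamma>"
  shows "\<beta> 1 = \<gamma> 1"
proof -
  obtain l where "path_homotopic X \<beta> (path_join l \<gamma>)"
    using assms(3) cls_eq_iff[OF assms(1,2)] by blast
  from path_homotopic_endpoints(2)[OF this] show ?thesis by simp
qed

lemma cls_join_cong:
  assumes \<beta>: "\<beta> \<in> P" and \<gamma>: "\<gamma> \<in> P" and eq: "cls \<beta> = cls \<gamma>"
    and \<mu>: "pathin X \<mu>" "\<mu> 0 = \<beta> 1"
  shows "cls (path_join \<beta> \<mu>) = cls (path_join \<gamma> \<mu>)"
proof -
  have ends: "\<beta> 1 = \<gamma> 1"
    using cls_eq_imp_end_eq[OF \<beta> \<gamma> eq] .
  obtain l where l: "l \<in> L" and hom: "path_homotopic X \<beta> (path_join l \<gamma>)"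
    using eq cls_eq_iff[OF \<beta> \<gamma>] by blast
  note c = based_pathsD[OF \<gamma>] and l' = loops_subtopologyD[OF l]
  have "path_homotopic X (path_join \<beta> \<mu>) (path_join (path_join l \<gamma>) \<mu>)"
    by (intro path_homotopic_join hom path_homotopic_refl \<mu>) (simp add: \<mu>)
  also have "path_homotopic X \<dots> (path_join l (path_join \<gamma> \<mu>))"
    by (intro path_homotopic_assoc l' c \<mu>) (simp_all add: l' c \<mu> ends)
  finally show ?thesis
    using l path_join_in_based_paths[OF \<beta> \<mu>] path_join_in_based_paths[OF \<gamma> \<mu>(1)] \<mu>(2) ends
    by (subst cls_eq_iff) auto
qed

lemma cover_set_eq: "cover_set X x0 G = cls ` P"
  by (auto simp: cover_set_def quotient_def cover_class_def)

lemma in_cls: "\<beta> \<in> P \<Longrightarrow> \<beta> \<in> cls \<beta>"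
  unfolding cover_class_def using equiv_class_self[OF equiv_cover_rel] .

lemma in_clsD:
  assumes "\<gamma> \<in> cls \<beta>"
  shows "\<gamma> \<in> P" "cls \<gamma> = cls \<beta>"
  using assms equiv_class_eq[OF equiv_cover_rel, of \<beta> \<gamma>] cover_rel_iff[of \<beta> \<gamma>]
  by (auto simp: cover_class_def)

lemma cover_proj_cls:
  assumes "\<beta> \<in> P"
  shows "cover_proj (cls \<beta>) = \<beta> 1"
proof -
  have "(\<lambda>\<gamma>. \<gamma> 1) ` cls \<beta> = {\<beta> 1}"
  proof (intro equalityI subsetI)
    fix x assume "x \<in> (\<lambda>\<gamma>. \<gamma> 1) ` cls \<beta>"
    then obtain \<gamma> where "\<gamma> \<in> cls \<beta>" "x = \<gamma> 1" by blast
    then show "x \<in> {\<beta> 1}"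
      using cls_eq_imp_end_eq[OF _ assms] in_clsD by simp
  qed (use in_cls[OF assms] in blast)
  then show ?thesis
    by (simp add: cover_proj_def)
qed

lemma nbhdE:
  assumes "c \<in> nbhd \<beta> U"
  obtains l where "c = cls (path_join \<beta> l)" "pathin (subtopology X U) l" "pathin X l" "l 0 = \<beta> 1" "l 1 \<in> U"
proof -
  obtain l where l: "c = cls (path_join \<beta> l)" "pathin (subtopology X U) l" "l 0 = \<beta> 1"
    using assms unfolding cover_nbhd_def by blast
  moreover have "pathin X l"
    using l(2) continuous_map_into_fulltopology unfolding pathin_def by blast
  moreover have "l 1 \<in> U"
    using l(2) by (auto simp: pathin_def continuous_map_in_subtopology)
  ultimately show ?thesis using that by blast
qed

lemma nbhd_subset: "\<beta> \<in> P \<Longrightarrow> nbhd \<beta> U \<subseteq> cover_set X x0 G"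
  unfolding cover_set_eq by (auto elim!: nbhdE intro: path_join_in_based_paths)

lemma cls_in_nbhd:
  assumes \<beta>: "\<beta> \<in> P" and "\<beta> 1 \<in> U"
  shows "cls \<beta> \<in> nbhd \<beta> U"
proof -
  note b = based_pathsD[OF \<beta>]
  have "\<beta> 1 \<in> topspace X"
    using based_paths_in_topspace[OF _ \<beta>] by simp
  then have const: "pathin (subtopology X U) (\<lambda>_. \<beta> 1)" "pathin X (\<lambda>_. \<beta> 1)"
    using assms(2) by (auto simp: pathin_def)
  have "cls (path_join \<beta> (\<lambda>_. \<beta> 1)) = cls \<beta>"
    using \<beta> const b by (intro cls_eqI path_join_in_based_paths path_homotopic_right_unit) auto
  then show ?thesis
    unfolding cover_nbhd_def using const by force
qed

text \<open>
  If \<open>\<gamma>\<close> is equivalent to \<open>\<beta>\<close> followed by a path in \<open>U\<close>, then any continuation of \<open>\<gamma>\<close> inside \<open>U\<close> is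
  equivalent to a continuation of \<open>\<beta>\<close> inside \<open>U\<close>, by associativity. This makes the generating sets a
  basis, and reduces openness questions to the centre of a neighbourhood.
\<close>

lemma nbhd_recentre_subset:
  assumes \<beta>: "\<beta> \<in> P" and \<gamma>: "\<gamma> \<in> P" and mem: "cls \<gamma> \<in> nbhd \<beta> U"
  shows "nbhd \<gamma> U \<subseteq> nbhd \<beta> U"
proof
  fix c assume "c \<in> nbhd \<gamma> U"
  then obtain m where m: "c = cls (path_join \<gamma> m)" "pathin (subtopology X U) m" "pathin X m" "m 0 = \<gamma> 1"
    by (rule nbhdE)
  obtain l where l: "cls \<gamma> = cls (path_join \<beta> l)" "pathin (subtopology X U) l" "pathin X l" "l 0 = \<beta> 1"
    using mem by (rule nbhdE)
  note b = based_pathsD[OF \<beta>]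
  have \<beta>l: "path_join \<beta> l \<in> P"
    using \<beta> l by (intro path_join_in_based_paths)
  have ends: "l 1 = m 0"
    using cls_eq_imp_end_eq[OF \<gamma> \<beta>l l(1)] m by simp
  have "c = cls (path_join (path_join \<beta> l) m)"
    unfolding m(1) using cls_join_cong[OF \<gamma> \<beta>l l(1) m(3,4)] .
  also have "\<dots> = cls (path_join \<beta> (path_join l m))"
    using b l m ends \<beta> \<beta>l
    by (intro cls_eqI path_homotopic_assoc path_join_in_based_paths pathin_join) auto
  finally show "c \<in> nbhd \<beta> U"
    unfolding cover_nbhd_def using pathin_join[OF l(2) m(2) ends] l(4) by auto
qed

lemma openin_nbhd:
  assumes "\<beta> \<in> P" "openin X U" "\<beta> 1 \<in> U"
  shows "openin XG (nbhd \<beta> U)"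
  unfolding cover_topology_def using assms by (intro topology_generated_by_Basis) blast

lemma topspace_XG: "topspace XG = cover_set X x0 G"
proof
  show "topspace XG \<subseteq> cover_set X x0 G"
    using nbhd_subset by (auto simp: cover_topology_def)
  have "cls \<beta> \<in> topspace XG" if "\<beta> \<in> P" for \<beta>
  proof -
    have "\<beta> 1 \<in> topspace X"
      using based_paths_in_topspace[OF _ that] by simp
    then show ?thesis
      using openin_subset[OF openin_nbhd[OF that openin_topspace]] cls_in_nbhd[OF that] by blast
  qed
  then show "cover_set X x0 G \<subseteq> topspace XG"
    by (auto simp: cover_set_eq)
qed

lemma continuous_cover_proj: "continuous_map XG X cover_proj"
  unfolding continuous_map_def
proof (intro conjI allI impI)
  show "cover_proj \<in> topspace XG \<rightarrow> topspace X"
    using based_paths_in_topspace[of 1] by (auto simp: topspace_XG cover_set_eq cover_proj_cls)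
  fix U assume U: "openin X U"
  show "openin XG {c \<in> topspace XG. cover_proj c \<in> U}"
  proof (subst openin_subopen, intro ballI)
    fix c assume "c \<in> {c \<in> topspace XG. cover_proj c \<in> U}"
    then obtain \<beta> where \<beta>: "\<beta> \<in> P" "c = cls \<beta>" "\<beta> 1 \<in> U"
      by (auto simp: topspace_XG cover_set_eq cover_proj_cls)
    have "cover_proj d \<in> U" if "d \<in> nbhd \<beta> U" for d
      using that \<beta>(1) by (elim nbhdE) (simp add: cover_proj_cls path_join_in_based_paths)
    moreover have "nbhd \<beta> U \<subseteq> topspace XG"
      using nbhd_subset[OF \<beta>(1)] by (simp add: topspace_XG)
    ultimately show "\<exists>W. openin XG W \<and> c \<in> W \<and> W \<subseteq> {c \<in> topspace XG. cover_proj c \<in> U}"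
      using openin_nbhd[OF \<beta>(1) U \<beta>(3)] cls_in_nbhd[OF \<beta>(1,3)] \<beta>(2) by blast
  qed
qed

end

section \<open>The constants of a theory with a zero algebra\<close>

definition op_tuple :: "'m alg_theory \<Rightarrow> nat \<Rightarrow> nat \<Rightarrow> (nat \<Rightarrow> 'm) \<Rightarrow> 'm" where
  "op_tuple T m n x = (THE u. u \<in> homset T m n \<and> (\<forall>i<n. Comp T (Proj T n i) u = x i))"

text \<open>
  Substitution makes the \<open>m\<close>-ary operations into the free algebra on \<open>m\<close> generators. The arity of
  \<open>\<tau>\<close> is recovered as its domain.
\<close>

definition op_subst :: "'m alg_theory \<Rightarrow> nat \<Rightarrow> 'm \<Rightarrow> (nat \<Rightarrow> 'm) \<Rightarrow> 'm" where
  "op_subst T m \<tau> x = Comp T \<tau> (op_tuple T m (Dom T \<tau>) x)"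

lemma Comp_in_homset:
  assumes "category C" "f \<in> homset C a b" "g \<in> homset C b d"
  shows "Comp C g f \<in> homset C a d"
proof -
  have "f \<in> Arr C" "g \<in> Arr C" "Cod C f = Dom C g" and [simp]: "Dom C f = a" "Cod C g = d"
    using assms(2,3) by (simp_all add: homset_def)
  then have "Comp C g f \<in> homset C (Dom C f) (Cod C g)"
    using assms(1) unfolding category_def by blast
  then show ?thesis by simp
qed

lemma Comp_assoc:
  assumes "category C" "f \<in> homset C a b" "g \<in> homset C b c" "h \<in> homset C c d"
  shows "Comp C h (Comp C g f) = Comp C (Comp C h g) f"
proof -
  have "f \<in> Arr C" "g \<in> Arr C" "h \<in> Arr C" "Cod C f = Dom C g" "Cod C g = Dom C h"
    using assms(2-4) by (simp_all add: homset_def)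
  then show ?thesis
    using assms(1) unfolding category_def by blast
qed

lemma t_algebra_closed:
  assumes "t_algebra T A \<alpha>" "\<tau> \<in> operations T n" "x \<in> {..<n} \<rightarrow>\<^sub>E A"
  shows "\<alpha> \<tau> x \<in> A"
proof -
  have "\<forall>n. \<forall>\<tau>\<in>operations T n. \<alpha> \<tau> \<in> ({..<n} \<rightarrow>\<^sub>E A) \<rightarrow> A"
    using assms(1) unfolding t_algebra_def by (elim conjE)
  then have "\<alpha> \<tau> \<in> ({..<n} \<rightarrow>\<^sub>E A) \<rightarrow> A"
    using assms(2) by blast
  then show ?thesis
    using assms(3) by (rule funcset_mem)
qed

lemma t_algebra_Proj:
  assumes "t_algebra T A \<alpha>" "i < n" "x \<in> {..<n} \<rightarrow>\<^sub>E A"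
  shows "\<alpha> (Proj T n i) x = x i"
proof -
  have "\<forall>n. \<forall>i<n. \<forall>x\<in>{..<n} \<rightarrow>\<^sub>E A. \<alpha> (Proj T n i) x = x i"
    using assms(1) unfolding t_algebra_def by (elim conjE)
  then show ?thesis
    using assms(2,3) by blast
qed

lemma t_algebra_Comp:
  assumes "t_algebra T A \<alpha>" "\<tau> \<in> operations T n" "f \<in> homset T m n" "x \<in> {..<m} \<rightarrow>\<^sub>E A"
  shows "\<alpha> (Comp T \<tau> f) x = \<alpha> \<tau> (\<lambda>i\<in>{..<n}. \<alpha> (Comp T (Proj T n i) f) x)"
proof -
  have "\<forall>m n. \<forall>\<tau>\<in>operations T n. \<forall>f\<in>homset T m n. \<forall>x\<in>{..<m} \<rightarrow>\<^sub>E A.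
      \<alpha> (Comp T \<tau> f) x = \<alpha> \<tau> (\<lambda>i\<in>{..<n}. \<alpha> (Comp T (Proj T n i) f) x)"
    using assms(1) unfolding t_algebra_def by (elim conjE)
  then show ?thesis
    using assms(2-4) by blast
qed

lemma Dom_operations: "\<tau> \<in> operations T n \<Longrightarrow> Dom T \<tau> = n"
  by (simp add: operations_def homset_def)

context
  fixes T :: "'m alg_theory"
  assumes T: "algebraic_theory T"
begin

lemma category_T: "category T"
  using T by (simp add: algebraic_theory_def)

lemma Proj_in_operations: "i < n \<Longrightarrow> Proj T n i \<in> operations T n"
  using T by (auto simp: algebraic_theory_def is_product_def operations_def)

lemma ex1_op_tuple:
  assumes "\<And>i. i < n \<Longrightarrow> x i \<in> operations T m"
  shows "\<exists>!u. u \<in> homset T m n \<and> (\<forall>i<n. Comp T (Proj T n i) u = x i)"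
proof -
  have "is_product T {..<n} (\<lambda>_. 1) n (Proj T n)" "m \<in> Obj T"
    using T by (auto simp: algebraic_theory_def)
  moreover have "\<forall>i\<in>{..<n}. x i \<in> homset T m 1"
    using assms by (simp add: operations_def)
  ultimately have "\<exists>!u. u \<in> homset T m n \<and> (\<forall>i\<in>{..<n}. Comp T (Proj T n i) u = x i)"
    unfolding is_product_def by blast
  then show ?thesis
    by (simp only: Ball_def lessThan_iff)
qed

lemma op_tuple:
  assumes "\<And>i. i < n \<Longrightarrow> x i \<in> operations T m"
  shows "op_tuple T m n x \<in> homset T m n"
    and "i < n \<Longrightarrow> Comp T (Proj T n i) (op_tuple T m n x) = x i"
proof -
  have "op_tuple T m n x \<in> homset T m n \<and> (\<forall>i<n. Comp T (Proj T n i) (op_tuple T m n x) = x i)"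
    unfolding op_tuple_def by (rule theI'[OF ex1_op_tuple]) (rule assms)
  then show "op_tuple T m n x \<in> homset T m n"
    and "i < n \<Longrightarrow> Comp T (Proj T n i) (op_tuple T m n x) = x i"
    by simp_all
qed

lemma op_tuple_eqI:
  assumes u: "u \<in> homset T m n" and "\<And>i. i < n \<Longrightarrow> Comp T (Proj T n i) u = x i"
  shows "op_tuple T m n x = u"
proof -
  have "x i \<in> operations T m" if "i < n" for i
    using Comp_in_homset[OF category_T u, of "Proj T n i" 1] Proj_in_operations[OF that]
      assms(2)[OF that]
    by (simp add: operations_def)
  then have "\<exists>!u. u \<in> homset T m n \<and> (\<forall>i<n. Comp T (Proj T n i) u = x i)"
    by (rule ex1_op_tuple)
  then show ?thesis
    unfolding op_tuple_def by (rule the1_equality) (use assms in blast)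
qed

lemma operations_t_algebra: "t_algebra T (operations T m) (op_subst T m)"
  unfolding t_algebra_def
proof (intro conjI allI impI ballI)
  fix n \<tau> assume \<tau>: "\<tau> \<in> operations T n"
  show "op_subst T m \<tau> \<in> ({..<n} \<rightarrow>\<^sub>E operations T m) \<rightarrow> operations T m"
  proof
    fix x assume "x \<in> {..<n} \<rightarrow>\<^sub>E operations T m"
    then have "op_tuple T m n x \<in> homset T m n"
      by (intro op_tuple) auto
    then show "op_subst T m \<tau> x \<in> operations T m"
      using Comp_in_homset[OF category_T] \<tau>
      by (auto simp: op_subst_def Dom_operations[OF \<tau>] operations_def)
  qed
next
  fix n i :: nat and x assume i: "i < n" and x: "x \<in> {..<n} \<rightarrow>\<^sub>E operations T m"
  then show "op_subst T m (Proj T n i) x = x i"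
    using op_tuple(2)[of n x m i] by (auto simp: op_subst_def Dom_operations[OF Proj_in_operations[OF i]])
next
  fix k n \<tau> f x
  assume \<tau>: "\<tau> \<in> operations T n" and f: "f \<in> homset T k n" and x: "x \<in> {..<k} \<rightarrow>\<^sub>E operations T m"
  define u where "u = op_tuple T m k x"
  have u: "u \<in> homset T m k"
    unfolding u_def using x by (intro op_tuple) auto
  have fu: "Comp T f u \<in> homset T m n"
    using Comp_in_homset[OF category_T u f] .
  have dom: "Dom T (Comp T \<sigma> f) = k" if "\<sigma> \<in> operations T n" for \<sigma>
    using Comp_in_homset[OF category_T f] that by (auto simp: operations_def homset_def)
  have assoc: "op_subst T m (Comp T \<sigma> f) x = Comp T \<sigma> (Comp T f u)" if "\<sigma> \<in> operations T n" for \<sigma>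
    using Comp_assoc[OF category_T u f] that
    by (simp add: op_subst_def dom[OF that] u_def[symmetric] operations_def)
  have "op_tuple T m n (\<lambda>i\<in>{..<n}. op_subst T m (Comp T (Proj T n i) f) x) = Comp T f u"
    using fu by (rule op_tuple_eqI) (simp add: assoc Proj_in_operations)
  then show "op_subst T m (Comp T \<tau> f) x =
      op_subst T m \<tau> (\<lambda>i\<in>{..<n}. op_subst T m (Comp T (Proj T n i) f) x)"
    using assoc[OF \<tau>] by (simp add: op_subst_def[of T m \<tau>] Dom_operations[OF \<tau>])
qed

lemma const_value_operations:
  assumes c: "c \<in> operations T 0"
  shows "const_value (op_subst T 0) c = c"
proof -
  have "0 \<in> Obj T" "c \<in> Arr T"
    using T c by (simp_all add: algebraic_theory_def operations_def homset_def)
  then have "Ident T 0 \<in> homset T 0 0" "Comp T c (Ident T (Dom T c)) = c"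
    using category_T unfolding category_def by blast+
  moreover from this(1) have "op_tuple T 0 0 (\<lambda>_. undefined) = Ident T 0"
    by (rule op_tuple_eqI) simp
  ultimately show ?thesis
    by (simp add: const_value_def op_subst_def Dom_operations[OF c])
qed

end

lemma singleton_t_algebra: "t_algebra T {u} (\<lambda>_ _. u)"
  by (simp add: t_algebra_def PiE_iff)

lemma t_homomorphism_const_value:
  assumes "t_homomorphism T A \<alpha> A' \<alpha>' f" "c \<in> operations T 0"
  shows "f (const_value \<alpha> c) = const_value \<alpha>' c"
proof -
  have "(\<lambda>_. undefined) \<in> {..<0::nat} \<rightarrow>\<^sub>E A" and empty: "(\<lambda>i\<in>{..<0::nat}. f undefined) = (\<lambda>_. undefined)"
    by auto
  then have "f (\<alpha> c (\<lambda>_. undefined)) = \<alpha>' c (\<lambda>i\<in>{..<0::nat}. f undefined)"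
    using assms unfolding t_homomorphism_def by blast
  then show ?thesis
    unfolding const_value_def empty .
qed

text \<open>
  With a zero algebra \<open>z\<close> there are homomorphisms \<open>f\<close> from the one-element algebra to \<open>z\<close> and \<open>g\<close> from
  \<open>z\<close> to the algebra of all constants. Homomorphisms preserve the values of constants, so every
  constant is obtained from the single element by applying \<open>f\<close> and then \<open>g\<close>.
\<close>

lemma constant_unique:
  fixes T :: "'m alg_theory"
  assumes "semi_abelian_theory T" and c: "c \<in> operations T 0" and d: "d \<in> operations T 0"
  shows "c = d"
proof -
  let ?C = "algebra_category T :: (('m, 'm) alg, ('m, 'm) alg \<times> ('m \<Rightarrow> 'm) \<times> ('m, 'm) alg) cat"
  let ?pt = "({undefined}, \<lambda>_ _. undefined) :: ('m, 'm) alg"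
  let ?F = "(operations T 0, op_subst T 0)"
  have T: "algebraic_theory T"
    using assms(1) by (simp add: semi_abelian_theory_def)
  obtain z where z: "is_initial ?C z" "is_terminal ?C z"
    using assms(1)
    unfolding semi_abelian_theory_def semi_abelian_category_def has_zero_object_def by blast
  have hom: "\<exists>f. t_homomorphism T (fst A) (snd A) (fst A') (snd A') f"
    if "h \<in> homset ?C A A'" for h A A'
    using that by (auto simp: homset_def algebra_category_def)
  have "?pt \<in> Obj ?C" "?F \<in> Obj ?C"
    using singleton_t_algebra[of T] operations_t_algebra[OF T] by (auto simp: algebra_category_def)
  then obtain h k where "h \<in> homset ?C ?pt z" "k \<in> homset ?C z ?F"
    using z unfolding is_initial_def is_terminal_def by blast
  from this[THEN hom]
  obtain f g where f: "t_homomorphism T (fst ?pt) (snd ?pt) (fst z) (snd z) f"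
    and g: "t_homomorphism T (fst z) (snd z) (fst ?F) (snd ?F) g"
    by blast
  have "a = g (f undefined)" if "a \<in> operations T 0" for a
  proof -
    have "const_value (snd z) a = f undefined"
      using t_homomorphism_const_value[OF f that] by (simp add: const_value_def)
    moreover have "g (const_value (snd z) a) = a"
      using t_homomorphism_const_value[OF g that] const_value_operations[OF T that] by simp
    ultimately show ?thesis by simp
  qed
  from this[OF c] this[OF d] show "c = d" by simp
qed

text \<open>
  Substituting the constant \<open>e\<close> for all arguments of \<open>\<tau>\<close> gives a constant of the theory, which is \<open>e\<close>
  by uniqueness.
\<close>

lemma operation_fixes_constant:
  fixes T :: "'m alg_theory"
  assumes "semi_abelian_theory T" "t_algebra T A \<alpha>" "e \<in> operations T 0" and \<tau>: "\<tau> \<in> operations T n"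
  shows "\<alpha> \<tau> (\<lambda>i\<in>{..<n}. const_value \<alpha> e) = const_value \<alpha> e"
proof -
  have T: "algebraic_theory T"
    using assms(1) by (simp add: semi_abelian_theory_def)
  let ?u = "op_tuple T 0 n (\<lambda>_. e)"
  have u: "Comp T (Proj T n i) ?u = e" if "i < n" for i
    using op_tuple(2)[OF T, of n "\<lambda>_. e" 0] assms(3) that by auto
  have u0: "?u \<in> homset T 0 n"
    using op_tuple(1)[OF T, of n "\<lambda>_. e" 0] assms(3) by auto
  have "Comp T \<tau> ?u \<in> operations T 0"
    using Comp_in_homset[OF category_T[OF T] u0, of \<tau> 1] \<tau> by (simp add: operations_def)
  then have "Comp T \<tau> ?u = e"
    using assms(1,3) by (intro constant_unique)
  then have "const_value \<alpha> e = \<alpha> (Comp T \<tau> ?u) (\<lambda>_. undefined)"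
    by (simp add: const_value_def)
  also have "\<dots> = \<alpha> \<tau> (\<lambda>i\<in>{..<n}. \<alpha> (Comp T (Proj T n i) ?u) (\<lambda>_. undefined))"
    by (rule t_algebra_Comp[OF assms(2) \<tau> u0]) simp
  also have "(\<lambda>i\<in>{..<n}. \<alpha> (Comp T (Proj T n i) ?u) (\<lambda>_. undefined)) = (\<lambda>i\<in>{..<n}. const_value \<alpha> e)"
    by (rule restrict_ext) (simp add: u const_value_def)
  finally show ?thesis by (rule sym)
qed

section \<open>Operations on classes of paths\<close>

definition pointwise_op ::
  "('m \<Rightarrow> (nat \<Rightarrow> 'a) \<Rightarrow> 'a) \<Rightarrow> 'm \<Rightarrow> nat \<Rightarrow> (nat \<Rightarrow> real \<Rightarrow> 'a) \<Rightarrow> real \<Rightarrow> 'a" where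
  "pointwise_op \<alpha> \<tau> n \<beta> = (\<lambda>t. \<alpha> \<tau> (\<lambda>i\<in>{..<n}. \<beta> i t))"

lemma pointwise_op_path_join:
  "pointwise_op \<alpha> \<tau> n (\<lambda>i. path_join (\<beta> i) (\<gamma> i)) =
     path_join (pointwise_op \<alpha> \<tau> n \<beta>) (pointwise_op \<alpha> \<tau> n \<gamma>)"
  by (rule ext) (simp add: pointwise_op_def path_join_def)

lemma path_homotopic_pointwise_op:
  assumes \<alpha>: "continuous_map (product_topology (\<lambda>_. X) {..<n}) X (\<alpha> \<tau>)"
    and hom: "\<And>i. i < n \<Longrightarrow> path_homotopic X (\<beta> i) (\<gamma> i)"
  shows "path_homotopic X (pointwise_op \<alpha> \<tau> n \<beta>) (pointwise_op \<alpha> \<tau> n \<gamma>)"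
proof -
  let ?Q = "top_of_set ({0..1} \<times> {0..1}) :: (real \<times> real) topology"
  have "\<forall>i\<in>{..<n}. \<exists>h. continuous_map ?Q X h \<and>
          (\<forall>t\<in>{0..1}. h (0, t) = \<beta> i t \<and> h (1, t) = \<gamma> i t) \<and>
          (\<forall>s\<in>{0..1}. h (s, 0) = \<beta> i 0 \<and> h (s, 1) = \<beta> i 1)"
    using hom unfolding path_homotopic_iff by blast
  from bchoice[OF this] obtain h where "\<forall>i\<in>{..<n}. continuous_map ?Q X (h i) \<and>
          (\<forall>t\<in>{0..1}. h i (0, t) = \<beta> i t \<and> h i (1, t) = \<gamma> i t) \<and>
          (\<forall>s\<in>{0..1}. h i (s, 0) = \<beta> i 0 \<and> h i (s, 1) = \<beta> i 1)"
    by blast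
  then have h: "\<And>i. i < n \<Longrightarrow> continuous_map ?Q X (h i)"
      "\<And>i t. i < n \<Longrightarrow> t \<in> {0..1} \<Longrightarrow> h i (0, t) = \<beta> i t \<and> h i (1, t) = \<gamma> i t"
      "\<And>i s. i < n \<Longrightarrow> s \<in> {0..1} \<Longrightarrow> h i (s, 0) = \<beta> i 0 \<and> h i (s, 1) = \<beta> i 1"
    by simp_all
  define k where "k = \<alpha> \<tau> \<circ> (\<lambda>z. \<lambda>i\<in>{..<n}. h i z)"
  have "continuous_map ?Q (product_topology (\<lambda>_. X) {..<n}) (\<lambda>z. \<lambda>i\<in>{..<n}. h i z)"
    unfolding continuous_map_componentwise using h(1) by auto
  then have "continuous_map ?Q X k"
    unfolding k_def using \<alpha> by (rule continuous_map_compose)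
  moreover have "k (0, t) = pointwise_op \<alpha> \<tau> n \<beta> t" "k (1, t) = pointwise_op \<alpha> \<tau> n \<gamma> t"
    if "t \<in> {0..1}" for t
    using that by (simp_all add: k_def pointwise_op_def h(2) cong: restrict_cong)
  moreover have "k (s, 0) = pointwise_op \<alpha> \<tau> n \<beta> 0" "k (s, 1) = pointwise_op \<alpha> \<tau> n \<beta> 1"
    if "s \<in> {0..1}" for s
    using that by (simp_all add: k_def pointwise_op_def h(3) cong: restrict_cong)
  ultimately show ?thesis
    unfolding path_homotopic_iff by (intro exI[of _ k]) simp
qed

lemma pathin_pointwise_op:
  assumes "continuous_map (product_topology (\<lambda>_. X) {..<n}) X (\<alpha> \<tau>)"
    and "\<And>i. i < n \<Longrightarrow> pathin X (\<beta> i)"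
  shows "pathin X (pointwise_op \<alpha> \<tau> n \<beta>)"
  by (rule path_homotopic_imp_pathin(1)[OF path_homotopic_pointwise_op])
     (use assms path_homotopic_refl in blast)+

lemma pathin_subtopology_iff:
  "pathin (subtopology X U) \<beta> \<longleftrightarrow> pathin X \<beta> \<and> (\<forall>t\<in>{0..1}. \<beta> t \<in> U)"
  by (auto simp: pathin_def continuous_map_in_subtopology)

text \<open>
  The base point being fixed by all operations is what keeps the set of paths from \<open>x0\<close>, and the set
  of loops at \<open>x0\<close>, closed under pointwise operations.
\<close>

locale path_space_mod_subalgebra = path_space_mod_subspace X S x0
  for X :: "'a topology" and S x0 +
  fixes T :: "'m alg_theory" and \<alpha> :: "'m \<Rightarrow> (nat \<Rightarrow> 'a) \<Rightarrow> 'a"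
  assumes theory_T: "algebraic_theory T"
    and topological_algebra_X: "topological_t_algebra T X \<alpha>"
    and subalgebra_S: "sub_t_algebra T (topspace X) \<alpha> S"
    and operation_fixes_x0: "\<tau> \<in> operations T n \<Longrightarrow> \<alpha> \<tau> (\<lambda>i\<in>{..<n}. x0) = x0"
begin

lemma algebra_X: "t_algebra T (topspace X) \<alpha>"
  using topological_algebra_X by (simp add: topological_t_algebra_def)

lemma continuous_operation:
  "\<tau> \<in> operations T n \<Longrightarrow> continuous_map (product_topology (\<lambda>_. X) {..<n}) X (\<alpha> \<tau>)"
  using topological_algebra_X by (auto simp: topological_t_algebra_def)

lemma pointwise_op_eq_x0:
  assumes "\<tau> \<in> operations T n" "\<And>i. i < n \<Longrightarrow> \<beta> i t = x0"
  shows "pointwise_op \<alpha> \<tau> n \<beta> t = x0"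
proof -
  have "(\<lambda>i\<in>{..<n}. \<beta> i t) = (\<lambda>i\<in>{..<n}. x0)"
    using assms(2) by (intro restrict_ext) simp
  then show ?thesis
    using operation_fixes_x0[OF assms(1)] by (simp add: pointwise_op_def)
qed

lemma tuple_in_topspace:
  assumes "t \<in> {0..1}" "\<forall>i<n. \<beta> i \<in> P"
  shows "(\<lambda>i\<in>{..<n}. \<beta> i t) \<in> {..<n} \<rightarrow>\<^sub>E topspace X"
  using assms(2) by (auto intro!: based_paths_in_topspace[OF assms(1)])

lemma pointwise_op_in_P:
  assumes "\<tau> \<in> operations T n" "\<forall>i<n. \<beta> i \<in> P"
  shows "pointwise_op \<alpha> \<tau> n \<beta> \<in> P"
proof -
  have "pathin X (pointwise_op \<alpha> \<tau> n \<beta>)"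
    using assms by (intro pathin_pointwise_op continuous_operation) (auto dest: based_pathsD)
  moreover have "pointwise_op \<alpha> \<tau> n \<beta> 0 = x0"
    using assms by (intro pointwise_op_eq_x0) (auto dest: based_pathsD)
  ultimately show ?thesis by (simp add: based_paths_def)
qed

lemma pointwise_op_in_L:
  assumes \<tau>: "\<tau> \<in> operations T n" and l: "\<forall>i<n. l i \<in> L"
  shows "pointwise_op \<alpha> \<tau> n l \<in> L"
proof -
  have "pathin X (pointwise_op \<alpha> \<tau> n l)"
    using \<tau> l by (intro pathin_pointwise_op continuous_operation) (auto dest: loops_subtopologyD)
  moreover have "pointwise_op \<alpha> \<tau> n l t \<in> S" if t: "t \<in> {0..1}" for t
  proof -
    have "l i t \<in> S" if "i < n" for i
      using l that t by (auto simp: loops_def based_paths_def pathin_subtopology_iff)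
    then have "(\<lambda>i\<in>{..<n}. l i t) \<in> {..<n} \<rightarrow>\<^sub>E S"
      by auto
    then show ?thesis
      using subalgebra_S \<tau> unfolding sub_t_algebra_def pointwise_op_def by blast
  qed
  ultimately have "pathin (subtopology X S) (pointwise_op \<alpha> \<tau> n l)"
    by (simp add: pathin_subtopology_iff)
  moreover have "pointwise_op \<alpha> \<tau> n l 0 = x0" "pointwise_op \<alpha> \<tau> n l 1 = x0"
    using \<tau> l by (auto intro!: pointwise_op_eq_x0 dest: loops_subtopologyD)
  ultimately show ?thesis
    by (simp add: loops_def based_paths_def)
qed

text \<open>
  If \<open>\<beta>\<^sub>i\<close> is homotopic to \<open>l\<^sub>i\<close> followed by \<open>\<gamma>\<^sub>i\<close>, then \<open>\<tau>(\<beta>)\<close> is homotopic to \<open>\<tau>(l)\<close> followed by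
  \<open>\<tau>(\<gamma>)\<close>, and \<open>\<tau>(l)\<close> is again a loop in the subalgebra.
\<close>

lemma cls_pointwise_op_cong:
  assumes \<tau>: "\<tau> \<in> operations T n"
    and \<beta>: "\<forall>i<n. \<beta> i \<in> P" and \<gamma>: "\<forall>i<n. \<gamma> i \<in> P"
    and eq: "\<forall>i<n. cls (\<beta> i) = cls (\<gamma> i)"
  shows "cls (pointwise_op \<alpha> \<tau> n \<beta>) = cls (pointwise_op \<alpha> \<tau> n \<gamma>)"
proof -
  have "\<forall>i\<in>{..<n}. \<exists>l. l \<in> L \<and> path_homotopic X (\<beta> i) (path_join l (\<gamma> i))"
    using \<beta> \<gamma> eq by (auto simp: cls_eq_iff)
  then obtain l where l: "\<forall>i<n. l i \<in> L"
    and hom: "\<And>i. i < n \<Longrightarrow> path_homotopic X (\<beta> i) (path_join (l i) (\<gamma> i))"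
    using bchoice[of "{..<n}" "\<lambda>i l. l \<in> L \<and> path_homotopic X (\<beta> i) (path_join l (\<gamma> i))"] by auto
  have "path_homotopic X (pointwise_op \<alpha> \<tau> n \<beta>)
          (path_join (pointwise_op \<alpha> \<tau> n l) (pointwise_op \<alpha> \<tau> n \<gamma>))"
    unfolding pointwise_op_path_join[symmetric]
    by (intro path_homotopic_pointwise_op continuous_operation \<tau> hom)
  then show ?thesis
    using cls_eq_iff[OF pointwise_op_in_P[OF \<tau> \<beta>] pointwise_op_in_P[OF \<tau> \<gamma>]] pointwise_op_in_L[OF \<tau> l]
    by blast
qed

text \<open>
  The value is computed on arbitrarily chosen representatives; independence of the choice is the
  previous lemma.
\<close>

definition lifted_op :: "'m \<Rightarrow> (nat \<Rightarrow> (real \<Rightarrow> 'a) set) \<Rightarrow> (real \<Rightarrow> 'a) set" where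
  "lifted_op \<tau> c = cls (pointwise_op \<alpha> \<tau> (Dom T \<tau>) (\<lambda>i. SOME \<beta>. \<beta> \<in> c i))"

lemma lifted_op_cls:
  assumes \<tau>: "\<tau> \<in> operations T n" and \<beta>: "\<forall>i<n. \<beta> i \<in> P"
  shows "lifted_op \<tau> (\<lambda>i\<in>{..<n}. cls (\<beta> i)) = cls (pointwise_op \<alpha> \<tau> n \<beta>)"
proof -
  define \<gamma> where "\<gamma> i = (SOME \<gamma>. \<gamma> \<in> (\<lambda>i\<in>{..<n}. cls (\<beta> i)) i)" for i
  have "\<gamma> i \<in> cls (\<beta> i)" if "i < n" for i
    using someI[of "\<lambda>\<gamma>. \<gamma> \<in> cls (\<beta> i)", OF in_cls] \<beta> that by (simp add: \<gamma>_def)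
  then have "\<forall>i<n. \<gamma> i \<in> P" "\<forall>i<n. cls (\<gamma> i) = cls (\<beta> i)"
    using in_clsD by blast+
  then have "cls (pointwise_op \<alpha> \<tau> n \<gamma>) = cls (pointwise_op \<alpha> \<tau> n \<beta>)"
    using \<tau> \<beta> by (intro cls_pointwise_op_cong)
  then show ?thesis
    by (simp add: lifted_op_def Dom_operations[OF \<tau>] \<gamma>_def[abs_def])
qed

lemma classes_representatives:
  assumes "c \<in> {..<n} \<rightarrow>\<^sub>E cover_set X x0 G"
  obtains \<beta> where "\<forall>i<n. \<beta> i \<in> P" "c = (\<lambda>i\<in>{..<n}. cls (\<beta> i))"
proof -
  have "\<forall>i\<in>{..<n}. \<exists>\<beta>. \<beta> \<in> P \<and> c i = cls \<beta>"
    using assms by (auto simp: cover_set_eq dest: PiE_mem)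
  then obtain \<beta> where \<beta>: "\<forall>i\<in>{..<n}. \<beta> i \<in> P \<and> c i = cls (\<beta> i)"
    unfolding bchoice_iff by blast
  moreover have "c = (\<lambda>i\<in>{..<n}. cls (\<beta> i))"
    using assms \<beta> by (intro extensionalityI[of _ "{..<n}"]) (auto simp: PiE_iff)
  ultimately show ?thesis
    by (intro that[of \<beta>]) simp_all
qed

text \<open>
  On representatives, each law is the corresponding law in \<open>X\<close>, applied at every parameter in
  \<open>[0, 1]\<close>.
\<close>

lemma algebra_XG: "t_algebra T (cover_set X x0 G) lifted_op"
  unfolding t_algebra_def
proof (intro conjI allI impI ballI)
  fix n \<tau> assume \<tau>: "\<tau> \<in> operations T n"
  show "lifted_op \<tau> \<in> ({..<n} \<rightarrow>\<^sub>E cover_set X x0 G) \<rightarrow> cover_set X x0 G"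
  proof
    fix c assume "c \<in> {..<n} \<rightarrow>\<^sub>E cover_set X x0 G"
    then obtain \<beta> where \<beta>: "\<forall>i<n. \<beta> i \<in> P" "c = (\<lambda>i\<in>{..<n}. cls (\<beta> i))"
      by (rule classes_representatives) blast
    show "lifted_op \<tau> c \<in> cover_set X x0 G"
      unfolding \<beta>(2) lifted_op_cls[OF \<tau> \<beta>(1)] cover_set_eq
      using pointwise_op_in_P[OF \<tau> \<beta>(1)] by blast
  qed
next
  fix n i :: nat and c
  assume i: "i < n" and "c \<in> {..<n} \<rightarrow>\<^sub>E cover_set X x0 G"
  then obtain \<beta> where \<beta>: "\<forall>i<n. \<beta> i \<in> P" "c = (\<lambda>i\<in>{..<n}. cls (\<beta> i))"
    by (elim classes_representatives) blast
  have "lifted_op (Proj T n i) c = cls (pointwise_op \<alpha> (Proj T n i) n \<beta>)"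
    unfolding \<beta>(2) by (rule lifted_op_cls[OF Proj_in_operations[OF theory_T i] \<beta>(1)])
  also have "\<dots> = cls (\<beta> i)"
  proof (rule cls_cong[OF \<beta>(1)[rule_format, OF i]])
    fix t :: real assume "t \<in> {0..1}"
    then have "(\<lambda>i\<in>{..<n}. \<beta> i t) \<in> {..<n} \<rightarrow>\<^sub>E topspace X"
      using \<beta>(1) by (intro tuple_in_topspace)
    then show "pointwise_op \<alpha> (Proj T n i) n \<beta> t = \<beta> i t"
      using t_algebra_Proj[OF algebra_X i] i by (simp add: pointwise_op_def)
  qed
  finally show "lifted_op (Proj T n i) c = c i"
    using i \<beta>(2) by simp
next
  fix m n \<tau> f c
  assume \<tau>: "\<tau> \<in> operations T n" and f: "f \<in> homset T m n"
    and "c \<in> {..<m} \<rightarrow>\<^sub>E cover_set X x0 G"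
  then obtain \<beta> where \<beta>: "\<forall>i<m. \<beta> i \<in> P" "c = (\<lambda>i\<in>{..<m}. cls (\<beta> i))"
    by (elim classes_representatives) blast
  have comp_f: "Comp T \<sigma> f \<in> operations T m" if "\<sigma> \<in> operations T n" for \<sigma>
    using that Comp_in_homset[OF category_T[OF theory_T] f, of \<sigma> 1] by (simp add: operations_def)
  define \<gamma> where "\<gamma> i = pointwise_op \<alpha> (Comp T (Proj T n i) f) m \<beta>" for i
  have f_i: "Comp T (Proj T n i) f \<in> operations T m" if "i < n" for i
    using that by (intro comp_f Proj_in_operations theory_T)
  have \<gamma>: "\<forall>i<n. \<gamma> i \<in> P"
    unfolding \<gamma>_def using f_i \<beta>(1) by (simp add: pointwise_op_in_P)
  have "lifted_op (Comp T \<tau> f) c = cls (pointwise_op \<alpha> (Comp T \<tau> f) m \<beta>)"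
    unfolding \<beta>(2) by (rule lifted_op_cls[OF comp_f[OF \<tau>] \<beta>(1)])
  also have "\<dots> = cls (pointwise_op \<alpha> \<tau> n \<gamma>)"
  proof (rule cls_cong[OF pointwise_op_in_P[OF \<tau> \<gamma>]])
    fix t :: real assume "t \<in> {0..1}"
    then have "(\<lambda>i\<in>{..<m}. \<beta> i t) \<in> {..<m} \<rightarrow>\<^sub>E topspace X"
      using \<beta>(1) by (intro tuple_in_topspace)
    then show "pointwise_op \<alpha> (Comp T \<tau> f) m \<beta> t = pointwise_op \<alpha> \<tau> n \<gamma> t"
      using t_algebra_Comp[OF algebra_X \<tau> f] by (simp add: pointwise_op_def \<gamma>_def)
  qed
  also have "\<dots> = lifted_op \<tau> (\<lambda>i\<in>{..<n}. cls (\<gamma> i))"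
    by (rule lifted_op_cls[OF \<tau> \<gamma>, symmetric])
  also have "(\<lambda>i\<in>{..<n}. cls (\<gamma> i)) = (\<lambda>i\<in>{..<n}. lifted_op (Comp T (Proj T n i) f) c)"
    unfolding \<gamma>_def \<beta>(2) by (rule restrict_ext) (simp add: lifted_op_cls[OF f_i \<beta>(1)])
  finally show "lifted_op (Comp T \<tau> f) c =
      lifted_op \<tau> (\<lambda>i\<in>{..<n}. lifted_op (Comp T (Proj T n i) f) c)" .
qed

text \<open>
  The operation commutes with concatenation, so it maps continuations of the \<open>\<beta>\<^sub>i\<close> inside the \<open>V\<^sub>i\<close> to
  a continuation of \<open>\<tau>(\<beta>)\<close> inside \<open>U\<close>.
\<close>

lemma lifted_op_maps_nbhds:
  assumes \<tau>: "\<tau> \<in> operations T n" and \<beta>: "\<forall>i<n. \<beta> i \<in> P"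
    and V: "\<And>x. x \<in> {..<n} \<rightarrow>\<^sub>E topspace X \<Longrightarrow> (\<And>i. i < n \<Longrightarrow> x i \<in> V i) \<Longrightarrow> \<alpha> \<tau> x \<in> U"
    and d: "d \<in> (\<Pi>\<^sub>E i\<in>{..<n}. nbhd (\<beta> i) (V i))"
  shows "lifted_op \<tau> d \<in> nbhd (pointwise_op \<alpha> \<tau> n \<beta>) U"
proof -
  have "\<forall>i\<in>{..<n}. \<exists>l. d i = cls (path_join (\<beta> i) l) \<and> pathin (subtopology X (V i)) l \<and> l 0 = \<beta> i 1"
    using d unfolding cover_nbhd_def by (auto dest: PiE_mem)
  then obtain l where l: "\<forall>i\<in>{..<n}. d i = cls (path_join (\<beta> i) (l i)) \<and>
      pathin (subtopology X (V i)) (l i) \<and> l i 0 = \<beta> i 1"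
    unfolding bchoice_iff by blast
  have path_l: "pathin X (l i)" if "i < n" for i
    using l that by (simp add: pathin_subtopology_iff)
  have d_eq: "d = (\<lambda>i\<in>{..<n}. cls (path_join (\<beta> i) (l i)))"
    using d l by (intro extensionalityI[of _ "{..<n}"]) (auto simp: PiE_iff)
  have \<beta>l: "\<forall>i<n. path_join (\<beta> i) (l i) \<in> P"
    using l path_l \<beta> by (simp add: path_join_in_based_paths)
  have "lifted_op \<tau> d = cls (path_join (pointwise_op \<alpha> \<tau> n \<beta>) (pointwise_op \<alpha> \<tau> n l))"
    unfolding d_eq lifted_op_cls[OF \<tau> \<beta>l] pointwise_op_path_join ..
  moreover have "pointwise_op \<alpha> \<tau> n l t \<in> U" if t: "t \<in> {0..1}" for t
  proof -
    have "l i t \<in> V i \<and> l i t \<in> topspace X" if "i < n" for i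
    proof
      have "pathin (subtopology X (V i)) (l i)"
        using l that by simp
      then show "l i t \<in> V i"
        using t by (simp add: pathin_subtopology_iff)
      show "l i t \<in> topspace X"
        using path_l[OF that] t unfolding pathin_def continuous_map_def by auto
    qed
    then show ?thesis
      unfolding pointwise_op_def by (intro V) auto
  qed
  moreover have "pathin X (pointwise_op \<alpha> \<tau> n l)"
    by (intro pathin_pointwise_op continuous_operation \<tau> path_l)
  moreover have "pointwise_op \<alpha> \<tau> n l 0 = pointwise_op \<alpha> \<tau> n \<beta> 1"
    unfolding pointwise_op_def using l by (intro arg_cong[of _ _ "\<alpha> \<tau>"] restrict_ext) simp
  ultimately show ?thesis
    unfolding cover_nbhd_def pathin_subtopology_iff by blast
qed

lemma continuous_lifted_op:
  assumes \<tau>: "\<tau> \<in> operations T n"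
  shows "continuous_map (product_topology (\<lambda>_. XG) {..<n}) XG (lifted_op \<tau>)"
proof -
  let ?prod = "product_topology (\<lambda>_. XG) {..<n}"
  have preimage: "openin ?prod (lifted_op \<tau> -` nbhd \<delta> U \<inter> topspace ?prod)"
    if \<delta>: "\<delta> \<in> P" and U: "openin X U" for \<delta> U
  proof (subst openin_subopen, intro ballI)
    fix c assume c: "c \<in> lifted_op \<tau> -` nbhd \<delta> U \<inter> topspace ?prod"
    then have "c \<in> {..<n} \<rightarrow>\<^sub>E cover_set X x0 G"
      by (simp add: topspace_XG)
    then obtain \<beta> where \<beta>: "\<forall>i<n. \<beta> i \<in> P" and c_eq: "c = (\<lambda>i\<in>{..<n}. cls (\<beta> i))"
      by (rule classes_representatives) blast
    let ?b = "pointwise_op \<alpha> \<tau> n \<beta>"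
    have b: "?b \<in> P"
      using \<tau> \<beta> by (rule pointwise_op_in_P)
    (* Neighbourhoods can be recentred, so a neighbourhood of c is sought that the operation maps
       into nbhd ?b U. *)
    have b_mem: "cls ?b \<in> nbhd \<delta> U"
      using c by (simp add: c_eq lifted_op_cls[OF \<tau> \<beta>])
    have "?b 1 \<in> U"
      using b_mem
    proof (rule nbhdE)
      fix l assume "cls ?b = cls (path_join \<delta> l)" "pathin X l" "l 0 = \<delta> 1" "l 1 \<in> U"
      then show ?thesis
        using cls_eq_imp_end_eq[OF b path_join_in_based_paths[OF \<delta>]] by simp
    qed
    have \<beta>_end: "\<beta> i 1 \<in> topspace X" if "i < n" for i
      using based_paths_in_topspace[OF _ \<beta>[rule_format, OF that]] by simp
    let ?W = "{x \<in> topspace (product_topology (\<lambda>_. X) {..<n}). \<alpha> \<tau> x \<in> U}"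
    let ?x = "\<lambda>i\<in>{..<n}. \<beta> i 1"
    have "openin (product_topology (\<lambda>_. X) {..<n}) ?W"
      using continuous_operation[OF \<tau>] U by (rule openin_continuous_map_preimage)
    moreover have "?x \<in> ?W"
      using \<open>?b 1 \<in> U\<close> \<beta>_end by (auto simp: pointwise_op_def)
    ultimately obtain V where V: "\<And>i. i < n \<Longrightarrow> openin X (V i)" "?x \<in> Pi\<^sub>E {..<n} V"
        "Pi\<^sub>E {..<n} V \<subseteq> ?W"
      unfolding openin_product_topology_alt by (metis (no_types, lifting) lessThan_iff)
    have \<beta>V: "\<beta> i 1 \<in> V i" if "i < n" for i
      using PiE_mem[OF V(2), of i] that by simp
    define N where "N = (\<Pi>\<^sub>E i\<in>{..<n}. nbhd (\<beta> i) (V i))"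
    have "openin ?prod N"
      unfolding N_def
      using \<beta> V(1) \<beta>V by (simp add: openin_PiE openin_nbhd)
    moreover have "c \<in> N"
      unfolding c_eq N_def using \<beta> \<beta>V by (simp add: cls_in_nbhd)
    moreover have N_sub: "N \<subseteq> topspace ?prod"
      using \<beta> nbhd_subset unfolding N_def topspace_product_topology topspace_XG by (intro PiE_mono) auto
    have "lifted_op \<tau> d \<in> nbhd \<delta> U" if "d \<in> N" for d
    proof -
      have "\<alpha> \<tau> x \<in> U" if "x \<in> {..<n} \<rightarrow>\<^sub>E topspace X" "\<And>i. i < n \<Longrightarrow> x i \<in> V i" for x
      proof -
        have "x \<in> Pi\<^sub>E {..<n} V"
          using that by (auto simp: PiE_iff)
        then show ?thesis
          using V(3) by blast
      qed
      then have "lifted_op \<tau> d \<in> nbhd ?b U"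
        using that[unfolded N_def] by (rule lifted_op_maps_nbhds[OF \<tau> \<beta>])
      then show ?thesis
        using nbhd_recentre_subset[OF \<delta> b b_mem] by blast
    qed
    then have "N \<subseteq> lifted_op \<tau> -` nbhd \<delta> U \<inter> topspace ?prod"
      using N_sub by blast
    ultimately show "\<exists>N. openin ?prod N \<and> c \<in> N \<and> N \<subseteq> lifted_op \<tau> -` nbhd \<delta> U \<inter> topspace ?prod"
      by blast
  qed
  have "lifted_op \<tau> ` topspace ?prod \<subseteq> topspace XG"
    using t_algebra_closed[OF algebra_XG \<tau>] by (auto simp: topspace_XG)
  then show ?thesis
    using preimage unfolding cover_topology_def continuous_on_generated_topo_iff by auto
qed

lemma topological_algebra_XG: "topological_t_algebra T XG lifted_op"
  unfolding topological_t_algebra_def topspace_XG using algebra_XG continuous_lifted_op by blast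

lemma cover_proj_homomorphism:
  "t_homomorphism T (cover_set X x0 G) lifted_op (topspace X) \<alpha> cover_proj"
  unfolding t_homomorphism_def
proof (intro conjI allI ballI)
  show "cover_proj \<in> cover_set X x0 G \<rightarrow> topspace X"
    using based_paths_in_topspace[of 1] by (auto simp: cover_set_eq cover_proj_cls)
  fix n \<tau> c assume \<tau>: "\<tau> \<in> operations T n" and "c \<in> {..<n} \<rightarrow>\<^sub>E cover_set X x0 G"
  then obtain \<beta> where \<beta>: "\<forall>i<n. \<beta> i \<in> P" and c_eq: "c = (\<lambda>i\<in>{..<n}. cls (\<beta> i))"
    by (elim classes_representatives) blast
  have "cover_proj (lifted_op \<tau> c) = pointwise_op \<alpha> \<tau> n \<beta> 1"
    unfolding c_eq lifted_op_cls[OF \<tau> \<beta>] by (rule cover_proj_cls[OF pointwise_op_in_P[OF \<tau> \<beta>]])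
  also have "\<dots> = \<alpha> \<tau> (\<lambda>i\<in>{..<n}. cover_proj (c i))"
    unfolding pointwise_op_def c_eq
    by (intro arg_cong[of _ _ "\<alpha> \<tau>"] restrict_ext) (simp add: cover_proj_cls \<beta>)
  finally show "cover_proj (lifted_op \<tau> c) = \<alpha> \<tau> (\<lambda>i\<in>{..<n}. cover_proj (c i))" .
qed

end

theorem theorem3p4:
  fixes T :: "'m alg_theory"
    and e :: 'm
    and X :: "'a topology"
    and \<alpha> :: "'m \<Rightarrow> (nat \<Rightarrow> 'a) \<Rightarrow> 'a"
    and A' :: "'a set"
    and eA :: 'a
    and B :: "(real \<Rightarrow> 'a) set set"
  assumes "semi_abelian_theory T"
    and "e \<in> operations T 0"
    and "topological_t_algebra T X \<alpha>"
    and "sub_t_algebra T (topspace X) \<alpha> A'"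
    and "eA = const_value \<alpha> e"
    and "B = subspace_pi1 X A' eA"
  shows "\<exists>\<omega>.
    (\<forall>n. \<forall>\<tau>\<in>operations T n. \<forall>\<beta>. (\<forall>i<n. \<beta> i \<in> based_paths X eA) \<longrightarrow>
       \<omega> \<tau> (\<lambda>i\<in>{..<n}. cover_class X eA B (\<beta> i)) =
         cover_class X eA B (\<lambda>t. \<alpha> \<tau> (\<lambda>i\<in>{..<n}. \<beta> i t))) \<and>
    topspace (cover_topology X eA B) = cover_set X eA B \<and>
    topological_t_algebra T (cover_topology X eA B) \<omega> \<and>
    continuous_map (cover_topology X eA B) X cover_proj \<and>
    t_homomorphism T (cover_set X eA B) \<omega> (topspace X) \<alpha> cover_proj \<and>
    cover_proj (cover_class X eA B (\<lambda>_. eA)) = eA"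
proof -
  interpret path_space_mod_subalgebra X A' eA T \<alpha>
  proof
    show "A' \<subseteq> topspace X"
      using assms(4) by (simp add: sub_t_algebra_def)
    have "(\<lambda>_. undefined) \<in> {..<0::nat} \<rightarrow>\<^sub>E A'"
      by auto
    then show "eA \<in> A'"
      using assms(2,4,5) unfolding sub_t_algebra_def const_value_def by blast
    show "algebraic_theory T"
      using assms(1) by (simp add: semi_abelian_theory_def)
    fix \<tau> n assume "\<tau> \<in> operations T n"
    then show "\<alpha> \<tau> (\<lambda>i\<in>{..<n}. eA) = eA"
      unfolding assms(5) using assms(1-3)
      by (intro operation_fixes_constant[where A = "topspace X"]) (simp_all add: topological_t_algebra_def)
  qed (use assms(3,4) in simp_all)
  show ?thesis
    unfolding assms(6)
    using lifted_op_cls[unfolded pointwise_op_def] topspace_XG topological_algebra_XG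
      continuous_cover_proj cover_proj_homomorphism cover_proj_cls[OF const_in_P]
    by (intro exI[of _ lifted_op]) blast
qed

end
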